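(* Let $\Phi$ be simply-laced of rank $n$ with Coxeter number $h$, let $b$ be a positive integer coprime to $h$, let $\widetilde w_b\in\widetilde W$ be the unique element with $\widetilde w_b(\check\rho/h)=b\check\rho/h$, and set ${\sf zise}(x):={\sf size}(\widetilde w_b^{-1}(x))$. Then for all $x\in V$, \[{\sf zise}(x)=\frac h2\left\|x-b\frac{\check\rho}{h}\right\|^2-\frac{n(h+1)}{24}.\]
   Context: $\Phi$ is an irreducible crystallographic root system in a Euclidean space $V$, inner product normalized so the highest root $\tilde\alpha$ has $\|\tilde\alpha\|^2=2$; simply-laced means all roots have squared length $2$. Simple roots $\alpha_1,\dots,\alpha_n$, $h=1+\mathrm{ht}(\tilde\alpha)$ (height = sum of simple-root coefficients), $\rho=\frac12\sum_{\alpha\in\Phi^+}\alpha$, $\check\rho=\sum_i\check\omega_i$ with $\langle\check\omega_i,\alpha_j\rangle=\delta_{ij}$ (in the simply-laced case $\check\rho=\rho$), dual Coxeter number $g$ ($=h$ when simply-laced). ${\sf size}(x)=\frac g2\|x\|^2-\langle x,\rho\rangle$. $\widetilde W=W\ltimes\check Q$ is the affine Weyl group ($W$ the Weyl group, $\check Q$ the coroot lattice acting by translations). *)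

theory Defs
  imports "HOL-Analysis.Analysis" "HOL-Computational_Algebra.Group_Closure"
begin

definition reflection :: "'a::euclidean_space \<Rightarrow> 'a \<Rightarrow> 'a" where
  "reflection \<alpha> x = x - (2 * (x \<bullet> \<alpha>) / (\<alpha> \<bullet> \<alpha>)) *\<^sub>R \<alpha>"

definition coroot :: "'a::euclidean_space \<Rightarrow> 'a" where
  "coroot \<alpha> = (2 / (\<alpha> \<bullet> \<alpha>)) *\<^sub>R \<alpha>"

definition crystallographic_root_system :: "'a::euclidean_space set \<Rightarrow> bool" where
  "crystallographic_root_system \<Phi> \<longleftrightarrow>
     finite \<Phi> \<and> 0 \<notin> \<Phi> \<and> span \<Phi> = UNIV \<and>
     (\<forall>\<alpha>\<in>\<Phi>. reflection \<alpha> ` \<Phi> = \<Phi>) \<and>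
     (\<forall>\<alpha>\<in>\<Phi>. \<forall>c. c *\<^sub>R \<alpha> \<in> \<Phi> \<longrightarrow> c = 1 \<or> c = -1) \<and>
     (\<forall>\<alpha>\<in>\<Phi>. \<forall>\<beta>\<in>\<Phi>. \<beta> \<bullet> coroot \<alpha> \<in> \<int>)"

definition irreducible_root_system :: "'a::euclidean_space set \<Rightarrow> bool" where
  "irreducible_root_system \<Phi> \<longleftrightarrow>
     crystallographic_root_system \<Phi> \<and> \<Phi> \<noteq> {} \<and>
     \<not> (\<exists>A B. A \<noteq> {} \<and> B \<noteq> {} \<and> A \<union> B = \<Phi> \<and> A \<inter> B = {} \<and>
             (\<forall>\<alpha>\<in>A. \<forall>\<beta>\<in>B. \<alpha> \<bullet> \<beta> = 0))"

text \<open>With the inner product normalized so that the highest root has squared length 2,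
  all roots having the same length amounts to the following condition, which therefore
  includes the normalization.\<close>

definition simply_laced :: "'a::euclidean_space set \<Rightarrow> bool" where
  "simply_laced \<Phi> \<longleftrightarrow> (\<forall>\<alpha>\<in>\<Phi>. (norm \<alpha>)\<^sup>2 = 2)"

text \<open>For a system of simple roots \<open>\<Delta>\<close> (a basis of the space),
  \<^term>\<open>representation \<Delta> \<alpha> \<delta>\<close> is the coefficient of \<open>\<delta>\<close> in \<open>\<alpha>\<close>.\<close>

definition simple_roots :: "'a::euclidean_space set \<Rightarrow> 'a set \<Rightarrow> bool" where
  "simple_roots \<Phi> \<Delta> \<longleftrightarrow>
     \<Delta> \<subseteq> \<Phi> \<and> independent \<Delta> \<and> span \<Delta> = UNIV \<and>
     (\<forall>\<alpha>\<in>\<Phi>. (\<forall>\<delta>\<in>\<Delta>. representation \<Delta> \<alpha> \<delta> \<in> \<nat>) \<or>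
              (\<forall>\<delta>\<in>\<Delta>. - representation \<Delta> \<alpha> \<delta> \<in> \<nat>))"

definition positive_roots :: "'a::euclidean_space set \<Rightarrow> 'a set \<Rightarrow> 'a set" where
  "positive_roots \<Phi> \<Delta> = {\<alpha>\<in>\<Phi>. \<forall>\<delta>\<in>\<Delta>. representation \<Delta> \<alpha> \<delta> \<ge> 0}"

definition height :: "'a::euclidean_space set \<Rightarrow> 'a \<Rightarrow> real" where
  "height \<Delta> \<alpha> = (\<Sum>\<delta>\<in>\<Delta>. representation \<Delta> \<alpha> \<delta>)"

text \<open>The unique maximum of the root poset, where \<open>\<beta>\<close> is below \<open>\<theta>\<close> iff \<open>\<theta> - \<beta>\<close> is a
  nonnegative combination of simple roots.\<close>

definition highest_root :: "'a::euclidean_space set \<Rightarrow> 'a set \<Rightarrow> 'a" where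
  "highest_root \<Phi> \<Delta> =
     (THE \<theta>. \<theta> \<in> \<Phi> \<and>
        (\<forall>\<beta>\<in>\<Phi>. \<forall>\<delta>\<in>\<Delta>. representation \<Delta> \<beta> \<delta> \<le> representation \<Delta> \<theta> \<delta>))"

text \<open>Heights of roots are integers, so the floors below only convert the type.\<close>

definition coxeter_number :: "'a::euclidean_space set \<Rightarrow> 'a set \<Rightarrow> nat" where
  "coxeter_number \<Phi> \<Delta> = 1 + nat \<lfloor>height \<Delta> (highest_root \<Phi> \<Delta>)\<rfloor>"

text \<open>One plus the height of the coroot of the highest root in the dual root system,
  with respect to the simple coroots.\<close>

definition dual_coxeter_number :: "'a::euclidean_space set \<Rightarrow> 'a set \<Rightarrow> nat" where
  "dual_coxeter_number \<Phi> \<Delta> =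
     1 + nat \<lfloor>height (coroot ` \<Delta>) (coroot (highest_root \<Phi> \<Delta>))\<rfloor>"

definition weyl_vector :: "'a::euclidean_space set \<Rightarrow> 'a set \<Rightarrow> 'a" where
  "weyl_vector \<Phi> \<Delta> = (1 / 2) *\<^sub>R (\<Sum>\<alpha>\<in>positive_roots \<Phi> \<Delta>. \<alpha>)"

definition fundamental_coweight :: "'a::euclidean_space set \<Rightarrow> 'a \<Rightarrow> 'a" where
  "fundamental_coweight \<Delta> \<delta> =
     (THE w. \<forall>\<gamma>\<in>\<Delta>. w \<bullet> \<gamma> = (if \<gamma> = \<delta> then 1 else 0))"

definition weyl_covector :: "'a::euclidean_space set \<Rightarrow> 'a" where
  "weyl_covector \<Delta> = (\<Sum>\<delta>\<in>\<Delta>. fundamental_coweight \<Delta> \<delta>)"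

text \<open>Reflections are involutions, so the monoid they generate is already the Weyl group.\<close>

inductive_set weyl_group :: "('a::euclidean_space) set \<Rightarrow> ('a \<Rightarrow> 'a) set"
  for \<Phi> :: "'a set" where
  id: "id \<in> weyl_group \<Phi>"
| step: "w \<in> weyl_group \<Phi> \<Longrightarrow> \<alpha> \<in> \<Phi> \<Longrightarrow> reflection \<alpha> \<circ> w \<in> weyl_group \<Phi>"

definition coroot_lattice :: "'a::euclidean_space set \<Rightarrow> 'a set" where
  "coroot_lattice \<Phi> = group_closure (coroot ` \<Phi>)"

definition affine_weyl_group :: "'a::euclidean_space set \<Rightarrow> ('a \<Rightarrow> 'a) set" where
  "affine_weyl_group \<Phi> =
     {\<lambda>x. w x + q | w q. w \<in> weyl_group \<Phi> \<and> q \<in> coroot_lattice \<Phi>}"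

definition size_stat :: "'a::euclidean_space set \<Rightarrow> 'a set \<Rightarrow> 'a \<Rightarrow> real" where
  "size_stat \<Phi> \<Delta> x =
     real (dual_coxeter_number \<Phi> \<Delta>) / 2 * (norm x)\<^sup>2 - x \<bullet> weyl_vector \<Phi> \<Delta>"

definition affine_w :: "'a::euclidean_space set \<Rightarrow> 'a set \<Rightarrow> nat \<Rightarrow> ('a \<Rightarrow> 'a)" where
  "affine_w \<Phi> \<Delta> b =
     (THE w. w \<in> affine_weyl_group \<Phi> \<and>
        w ((1 / real (coxeter_number \<Phi> \<Delta>)) *\<^sub>R weyl_covector \<Delta>) =
          (real b / real (coxeter_number \<Phi> \<Delta>)) *\<^sub>R weyl_covector \<Delta>)"

definition zise_stat :: "'a::euclidean_space set \<Rightarrow> 'a set \<Rightarrow> nat \<Rightarrow> 'a \<Rightarrow> real" where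
  "zise_stat \<Phi> \<Delta> b x = size_stat \<Phi> \<Delta> (inv (affine_w \<Phi> \<Delta> b) x)"

end

theory Submission
  imports Defs
begin

text \<open>
  Completing the square in \<open>size\<close> at \<open>\<rho>/h\<close> and using that \<open>w\<^sub>b\<close> is an isometry carrying
  \<open>\<rho>/h\<close> to \<open>b\<rho>/h\<close> reduces the claim to the strange formula \<open>12 \<rho> \<bullet> \<rho> = n h (h + 1)\<close> and to the
  existence and uniqueness of \<open>w\<^sub>b\<close>.

  Strange formula: by irreducibility \<open>\<Sum>\<alpha>>0. (\<alpha> \<bullet> x)\<^sup>2\<close> is a multiple of \<open>x \<bullet> x\<close>; evaluation at the
  highest root shows that the factor is \<open>h\<close>, and the trace gives \<open>nh/2\<close> positive roots. Then
  \<open>4 \<rho> \<bullet> \<rho> = \<Sum>\<alpha>,\<beta>>0. \<alpha> \<bullet> \<beta>\<close> is found by counting the pairs with inner product \<open>1\<close> and \<open>-1\<close>,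
  which occur in the ratio 2 to 1 because each of them spans a subsystem of type \<open>A\<^sub>2\<close>.

  Existence: since \<open>b\<close> is coprime to \<open>h\<close>, the point \<open>b\<rho>/h\<close> lies on no affine reflection
  hyperplane; folding moves it into the open fundamental alcove, whose only point in
  \<open>P/h\<close> (\<open>P\<close> the weight lattice) is \<open>\<rho>/h\<close>. Uniqueness: if \<open>x \<mapsto> w x + q\<close> fixes \<open>\<rho>/h\<close>, then \<open>q\<close> pairs with every
  root to \<open>-1\<close>, \<open>0\<close> or \<open>1\<close>, which forces \<open>q = 0\<close>, and \<open>w\<close> fixes \<open>\<rho>\<close>, which forces \<open>w = id\<close>.
\<close>

section \<open>Inner products of roots, simple coordinates and heights\<close>

locale simply_laced_roots =
  fixes \<Phi> \<Delta> :: "'a::euclidean_space set"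
  assumes irreducible: "irreducible_root_system \<Phi>"
    and laced: "simply_laced \<Phi>"
    and simple: "simple_roots \<Phi> \<Delta>"
begin

abbreviation coef :: "'a \<Rightarrow> 'a \<Rightarrow> real"
  where "coef \<equiv> representation \<Delta>"

abbreviation pos :: "'a set"
  where "pos \<equiv> positive_roots \<Phi> \<Delta>"

abbreviation \<rho> :: 'a
  where "\<rho> \<equiv> weyl_covector \<Delta>"

lemma root_system: "crystallographic_root_system \<Phi>"
  using irreducible by (simp add: irreducible_root_system_def)

lemma finite_roots: "finite \<Phi>"
  and span_roots: "span \<Phi> = UNIV"
  using root_system by (auto simp: crystallographic_root_system_def)

lemma inner_root_self: "\<alpha> \<in> \<Phi> \<Longrightarrow> \<alpha> \<bullet> \<alpha> = 2"
  using laced by (simp add: simply_laced_def power2_norm_eq_inner)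

lemma coroot_root: "\<alpha> \<in> \<Phi> \<Longrightarrow> coroot \<alpha> = \<alpha>"
  by (simp add: coroot_def inner_root_self)

lemma reflection_root: "\<alpha> \<in> \<Phi> \<Longrightarrow> reflection \<alpha> x = x - (x \<bullet> \<alpha>) *\<^sub>R \<alpha>"
  by (simp add: reflection_def inner_root_self)

lemma inner_roots_Ints: "\<alpha> \<in> \<Phi> \<Longrightarrow> \<beta> \<in> \<Phi> \<Longrightarrow> \<alpha> \<bullet> \<beta> \<in> \<int>"
  using root_system by (metis crystallographic_root_system_def coroot_root)

lemma reflection_in_roots: "\<alpha> \<in> \<Phi> \<Longrightarrow> \<beta> \<in> \<Phi> \<Longrightarrow> reflection \<alpha> \<beta> \<in> \<Phi>"
  using root_system unfolding crystallographic_root_system_def by blast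

lemma uminus_root: "\<alpha> \<in> \<Phi> \<Longrightarrow> - \<alpha> \<in> \<Phi>"
  using reflection_in_roots[of \<alpha> \<alpha>] by (simp add: reflection_root inner_root_self scaleR_2)

lemma inner_reflection:
  "\<alpha> \<in> \<Phi> \<Longrightarrow> reflection \<alpha> x \<bullet> reflection \<alpha> y = x \<bullet> y"
  by (simp add: reflection_root inner_root_self inner_diff_left inner_diff_right inner_commute
      algebra_simps)

lemma reflection_reflection: "\<alpha> \<in> \<Phi> \<Longrightarrow> reflection \<alpha> (reflection \<alpha> x) = x"
  by (simp add: reflection_root inner_root_self inner_diff_left algebra_simps scaleR_2)

lemma linear_reflection: "linear (reflection \<alpha>)"
  by (rule linearI)
    (simp_all add: reflection_def inner_add_left algebra_simps add_divide_distrib)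

lemma root_eq_if_inner_2: "\<alpha> \<in> \<Phi> \<Longrightarrow> \<beta> \<in> \<Phi> \<Longrightarrow> \<alpha> \<bullet> \<beta> \<ge> 2 \<Longrightarrow> \<alpha> = \<beta>"
proof -
  assume a: "\<alpha> \<in> \<Phi>" "\<beta> \<in> \<Phi>" "\<alpha> \<bullet> \<beta> \<ge> 2"
  have "(\<alpha> - \<beta>) \<bullet> (\<alpha> - \<beta>) = 4 - 2 * (\<alpha> \<bullet> \<beta>)"
    using a by (simp add: inner_root_self inner_diff_left inner_diff_right inner_commute)
  then have "(\<alpha> - \<beta>) \<bullet> (\<alpha> - \<beta>) \<le> 0"
    using a by simp
  then show "\<alpha> = \<beta>"
    by (metis eq_iff_diff_eq_0 inner_ge_zero inner_eq_zero_iff antisym)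
qed

lemma root_eq_uminus_if_inner_minus_2:
  "\<alpha> \<in> \<Phi> \<Longrightarrow> \<beta> \<in> \<Phi> \<Longrightarrow> \<alpha> \<bullet> \<beta> \<le> - 2 \<Longrightarrow> \<alpha> = - \<beta>"
  using root_eq_if_inner_2[of \<alpha> "- \<beta>"] uminus_root by simp

text \<open>Integrality leaves -1, 0 and 1 strictly between -2 and 2. Outside this range the squared
  length of \<alpha> - \<beta> or \<alpha> + \<beta> is at most 0, which makes the roots equal or
  opposite.\<close>

lemma inner_roots_cases:
  assumes "\<alpha> \<in> \<Phi>" "\<beta> \<in> \<Phi>"
  obtains "\<alpha> = - \<beta>" | "\<alpha> \<bullet> \<beta> = -1" | "\<alpha> \<bullet> \<beta> = 0" | "\<alpha> \<bullet> \<beta> = 1" | "\<alpha> = \<beta>"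
proof -
  obtain k where k: "\<alpha> \<bullet> \<beta> = of_int k"
    using inner_roots_Ints[OF assms] by (auto elim: Ints_cases)
  consider "k \<le> -2" | "k = -1" | "k = 0" | "k = 1" | "k \<ge> 2"
    by linarith
  then show thesis
    using that k root_eq_if_inner_2[OF assms] root_eq_uminus_if_inner_minus_2[OF assms]
    by cases auto
qed

lemma root_diff: "\<alpha> \<in> \<Phi> \<Longrightarrow> \<beta> \<in> \<Phi> \<Longrightarrow> \<alpha> \<bullet> \<beta> = 1 \<Longrightarrow> \<alpha> - \<beta> \<in> \<Phi>"
  using reflection_in_roots[of \<beta> \<alpha>] by (simp add: reflection_root)

lemma root_add: "\<alpha> \<in> \<Phi> \<Longrightarrow> \<beta> \<in> \<Phi> \<Longrightarrow> \<alpha> \<bullet> \<beta> = -1 \<Longrightarrow> \<alpha> + \<beta> \<in> \<Phi>"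
  using reflection_in_roots[of \<beta> \<alpha>] by (simp add: reflection_root)

lemma simple_in_roots: "\<delta> \<in> \<Delta> \<Longrightarrow> \<delta> \<in> \<Phi>"
  and independent_simple: "independent \<Delta>"
  and span_simple: "span \<Delta> = UNIV"
  using simple by (auto simp: simple_roots_def)

lemma finite_simple: "finite \<Delta>"
  using simple_in_roots finite_roots by (meson finite_subset subsetI)

lemma coef_add: "coef (x + y) \<delta> = coef x \<delta> + coef y \<delta>"
  and coef_diff: "coef (x - y) \<delta> = coef x \<delta> - coef y \<delta>"
  and coef_uminus: "coef (- x) \<delta> = - coef x \<delta>"
  and coef_scaleR: "coef (r *\<^sub>R x) \<delta> = r * coef x \<delta>"
  by (simp_all add: independent_simple span_simple real_vector.representation_add
      real_vector.representation_diff real_vector.representation_neg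
      real_vector.representation_scale)

lemma coef_sum: "coef (sum f A) \<delta> = (\<Sum>a\<in>A. coef (f a) \<delta>)"
  by (simp add: independent_simple span_simple real_vector.representation_sum)

lemma coef_simple: "\<gamma> \<in> \<Delta> \<Longrightarrow> coef \<gamma> \<delta> = (if \<delta> = \<gamma> then 1 else 0)"
  by (simp add: independent_simple real_vector.representation_basis)

lemma sum_coef: "(\<Sum>\<delta>\<in>\<Delta>. coef x \<delta> *\<^sub>R \<delta>) = x"
  by (simp add: real_vector.sum_representation_eq independent_simple span_simple finite_simple)

lemma inner_coef: "x \<bullet> y = (\<Sum>\<delta>\<in>\<Delta>. coef x \<delta> * (\<delta> \<bullet> y))"
  by (subst sum_coef[of x, symmetric]) (simp add: inner_sum_left)

lemma coef_eqI: "(\<And>\<delta>. \<delta> \<in> \<Delta> \<Longrightarrow> coef x \<delta> = coef y \<delta>) \<Longrightarrow> x = y"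
  using sum_coef[of x] sum_coef[of y] by (metis (no_types, lifting) sum.cong)

lemma inner_simple_eqI:
  assumes "\<And>\<delta>. \<delta> \<in> \<Delta> \<Longrightarrow> x \<bullet> \<delta> = y \<bullet> \<delta>"
  shows "x = y"
proof -
  have "(x - y) \<bullet> (x - y) = (\<Sum>\<delta>\<in>\<Delta>. coef (x - y) \<delta> * (\<delta> \<bullet> (x - y)))"
    by (rule inner_coef)
  also have "\<dots> = 0"
    using assms by (intro sum.neutral) (auto simp: inner_diff_right inner_commute)
  finally show ?thesis
    by simp
qed

lemma pos_in_roots: "\<alpha> \<in> pos \<Longrightarrow> \<alpha> \<in> \<Phi>"
  by (simp add: positive_roots_def)

lemma coef_pos_nonneg: "\<alpha> \<in> pos \<Longrightarrow> \<delta> \<in> \<Delta> \<Longrightarrow> coef \<alpha> \<delta> \<ge> 0"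
  by (simp add: positive_roots_def)

lemma coef_root_Ints: "\<alpha> \<in> \<Phi> \<Longrightarrow> \<delta> \<in> \<Delta> \<Longrightarrow> coef \<alpha> \<delta> \<in> \<int>"
  using simple Nats_subset_Ints unfolding simple_roots_def
  by (metis minus_in_Ints_iff subsetD)

lemma pos_or_neg: "\<alpha> \<in> \<Phi> \<Longrightarrow> \<alpha> \<in> pos \<or> - \<alpha> \<in> pos"
  using simple uminus_root[of \<alpha>] unfolding simple_roots_def positive_roots_def
  by (fastforce simp: coef_uminus Nats_altdef2)

lemma pos_not_neg: "\<alpha> \<in> pos \<Longrightarrow> - \<alpha> \<notin> pos"
proof
  assume a: "\<alpha> \<in> pos" "- \<alpha> \<in> pos"
  have "\<alpha> = 0"
    using coef_pos_nonneg[OF a(1)] coef_pos_nonneg[OF a(2)]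
    by (intro coef_eqI) (force simp: coef_uminus real_vector.representation_zero)
  then show False
    using inner_root_self[OF pos_in_roots[OF a(1)]] by simp
qed

lemma pos_if_coef_pos: "\<alpha> \<in> \<Phi> \<Longrightarrow> \<delta> \<in> \<Delta> \<Longrightarrow> coef \<alpha> \<delta> > 0 \<Longrightarrow> \<alpha> \<in> pos"
  using pos_or_neg[of \<alpha>] coef_pos_nonneg[of "- \<alpha>" \<delta>] by (auto simp: coef_uminus)

lemma simple_pos: "\<delta> \<in> \<Delta> \<Longrightarrow> \<delta> \<in> pos"
  by (rule pos_if_coef_pos[of _ \<delta>]) (auto simp: simple_in_roots coef_simple)

lemma fundamental_coweight_inner:
  assumes "\<delta> \<in> \<Delta>" "\<gamma> \<in> \<Delta>"
  shows "fundamental_coweight \<Delta> \<delta> \<bullet> \<gamma> = (if \<gamma> = \<delta> then 1 else 0)"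
proof -
  let ?P = "\<lambda>w. \<forall>\<gamma>\<in>\<Delta>. w \<bullet> \<gamma> = (if \<gamma> = \<delta> then 1 else 0)"
  \<comment> \<open>This vector represents the linear functional \<open>coef _ \<delta>\<close> with
    respect to the inner product.\<close>
  let ?w = "\<Sum>e\<in>Basis. coef e \<delta> *\<^sub>R e"
  have "?w \<bullet> x = coef x \<delta>" for x
  proof -
    have "coef x \<delta> = coef (\<Sum>e\<in>Basis. (x \<bullet> e) *\<^sub>R e) \<delta>"
      by (simp add: euclidean_representation)
    also have "\<dots> = (\<Sum>e\<in>Basis. (x \<bullet> e) * coef e \<delta>)"
      by (simp add: coef_sum coef_scaleR)
    also have "\<dots> = ?w \<bullet> x"
      by (simp add: inner_sum_left inner_commute[of x] mult.commute)
    finally show ?thesis ..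
  qed
  then have "?P ?w"
    using assms(1) by (auto simp: coef_simple)
  moreover have "w = ?w" if "?P w" for w
    using that \<open>?P ?w\<close> by (intro inner_simple_eqI) auto
  ultimately have "?P (fundamental_coweight \<Delta> \<delta>)"
    unfolding fundamental_coweight_def by (rule theI[of ?P])
  then show ?thesis
    using assms(2) by blast
qed

lemma rho_simple: "\<gamma> \<in> \<Delta> \<Longrightarrow> \<gamma> \<bullet> \<rho> = 1"
  by (simp add: weyl_covector_def inner_commute[of \<gamma>] inner_sum_left fundamental_coweight_inner
      finite_simple)

lemma height_eq_inner: "height \<Delta> x = x \<bullet> \<rho>"
  by (simp add: height_def inner_coef[of x \<rho>] rho_simple)

lemma inner_rho_Ints: "\<alpha> \<in> \<Phi> \<Longrightarrow> \<alpha> \<bullet> \<rho> \<in> \<int>"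
  unfolding height_eq_inner[symmetric] height_def by (intro Ints_sum coef_root_Ints)

text \<open>The height is a sum of nonnegative integers, and it is nonzero because a root has some
  nonzero coefficient.\<close>

lemma inner_rho_pos:
  assumes "\<alpha> \<in> pos"
  shows "\<alpha> \<bullet> \<rho> \<ge> 1"
proof -
  have nonneg: "\<alpha> \<bullet> \<rho> \<ge> 0"
    unfolding height_eq_inner[symmetric] height_def
    by (intro sum_nonneg coef_pos_nonneg assms)
  have "\<alpha> \<bullet> \<rho> \<noteq> 0"
  proof
    assume "\<alpha> \<bullet> \<rho> = 0"
    then have "\<forall>\<delta>\<in>\<Delta>. coef \<alpha> \<delta> = 0"
      unfolding height_eq_inner[symmetric] height_def
      using coef_pos_nonneg[OF assms] finite_simple by (subst (asm) sum_nonneg_eq_0_iff) auto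
    then have "\<alpha> = 0"
      by (intro coef_eqI) (simp add: real_vector.representation_zero)
    then show False
      using inner_root_self[OF pos_in_roots[OF assms]] by simp
  qed
  then show ?thesis
    using nonneg inner_rho_Ints[OF pos_in_roots[OF assms]] Ints_nonzero_abs_ge1 by fastforce
qed

lemma pos_iff_inner_rho: "\<alpha> \<in> \<Phi> \<Longrightarrow> \<alpha> \<in> pos \<longleftrightarrow> \<alpha> \<bullet> \<rho> > 0"
  using pos_or_neg[of \<alpha>] inner_rho_pos[of \<alpha>] inner_rho_pos[of "- \<alpha>"] by auto

text \<open>A simple root other than \<open>\<alpha>\<close> occurs in \<open>\<beta>\<close>, and the reflection keeps its coefficient.\<close>

lemma reflection_simple_pos:
  assumes "\<alpha> \<in> \<Delta>" "\<beta> \<in> pos" "\<beta> \<noteq> \<alpha>"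
  shows "reflection \<alpha> \<beta> \<in> pos"
proof -
  have "\<exists>\<gamma>\<in>\<Delta>. \<gamma> \<noteq> \<alpha> \<and> coef \<beta> \<gamma> \<noteq> 0"
  proof (rule ccontr)
    assume none: "\<not> ?thesis"
    have "coef \<beta> \<gamma> = coef (coef \<beta> \<alpha> *\<^sub>R \<alpha>) \<gamma>" if "\<gamma> \<in> \<Delta>" for \<gamma>
      using none that assms(1) by (auto simp: coef_scaleR coef_simple)
    then have eq: "\<beta> = coef \<beta> \<alpha> *\<^sub>R \<alpha>"
      by (rule coef_eqI)
    then have "\<beta> \<bullet> \<beta> = (coef \<beta> \<alpha>)\<^sup>2 * (\<alpha> \<bullet> \<alpha>)"
      by (metis inner_scaleR_left inner_scaleR_right mult.assoc power2_eq_square)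
    then have "(coef \<beta> \<alpha>)\<^sup>2 = 1"
      using inner_root_self pos_in_roots simple_in_roots assms by simp
    then have "coef \<beta> \<alpha> = 1"
      using coef_pos_nonneg[OF assms(2,1)] power2_eq_1_iff by fastforce
    then show False
      using eq assms(3) by simp
  qed
  then obtain \<gamma> where g: "\<gamma> \<in> \<Delta>" "\<gamma> \<noteq> \<alpha>" "coef \<beta> \<gamma> > 0"
    using coef_pos_nonneg[OF assms(2)] by (metis less_eq_real_def)
  have "coef (reflection \<alpha> \<beta>) \<gamma> = coef \<beta> \<gamma>"
    using g assms by (simp add: reflection_root simple_in_roots coef_diff coef_scaleR coef_simple)
  then show ?thesis
    using pos_if_coef_pos[OF reflection_in_roots g(1)] g assms simple_in_roots pos_in_roots
    by simp
qed

lemma finite_pos: "finite pos"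
  using finite_roots pos_in_roots by (meson finite_subset subsetI)

text \<open>A simple reflection permutes the positive roots other than \<alpha>, so it fixes their
  sum, which is therefore orthogonal to \<alpha>. Only \<alpha> itself contributes to the pairing,
  namely 2, which is halved to 1.\<close>

lemma weyl_vector_eq_covector: "weyl_vector \<Phi> \<Delta> = \<rho>"
proof (rule inner_simple_eqI)
  fix \<alpha> assume a: "\<alpha> \<in> \<Delta>"
  then have r: "\<alpha> \<in> \<Phi>" and ap: "\<alpha> \<in> pos"
    by (auto simp: simple_in_roots simple_pos)
  let ?S = "\<Sum>(pos - {\<alpha>})"
  have bij: "bij_betw (reflection \<alpha>) (pos - {\<alpha>}) (pos - {\<alpha>})"
  proof (rule bij_betw_byWitness[where f' = "reflection \<alpha>"])
    have "reflection \<alpha> \<beta> \<noteq> \<alpha>" if "\<beta> \<in> pos" for \<beta>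
    proof
      assume "reflection \<alpha> \<beta> = \<alpha>"
      then have "\<beta> = reflection \<alpha> \<alpha>"
        using reflection_reflection[OF r] by metis
      then have "\<beta> = - \<alpha>"
        by (simp add: reflection_root r inner_root_self scaleR_2)
      then show False
        using that pos_not_neg[OF ap] by simp
    qed
    then show "reflection \<alpha> ` (pos - {\<alpha>}) \<subseteq> pos - {\<alpha>}"
      using reflection_simple_pos[OF a] by auto
    \<comment> \<open>The reflection is its own witness inverse, so both inclusion goals are the
      same statement.\<close>
    then show "reflection \<alpha> ` (pos - {\<alpha>}) \<subseteq> pos - {\<alpha>}" .
  qed (auto simp: reflection_reflection r)
  have "reflection \<alpha> ?S = (\<Sum>\<beta>\<in>pos - {\<alpha>}. reflection \<alpha> \<beta>)"
    by (rule linear_sum[OF linear_reflection])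
  also have "\<dots> = ?S"
    using sum.reindex_bij_betw[OF bij, of "\<lambda>x. x"] by simp
  finally have "(?S \<bullet> \<alpha>) *\<^sub>R \<alpha> = 0"
    by (simp add: reflection_root r)
  then have "?S \<bullet> \<alpha> = 0"
    using inner_root_self[OF r] by auto
  moreover have "\<Sum>pos = \<alpha> + ?S"
    using ap finite_pos by (simp add: sum.remove)
  ultimately show "weyl_vector \<Phi> \<Delta> \<bullet> \<alpha> = \<rho> \<bullet> \<alpha>"
    using rho_simple[OF a] inner_root_self[OF r]
    by (simp add: weyl_vector_def inner_add_left inner_commute[of \<rho>])
qed

subsection \<open>The highest root\<close>

abbreviation \<theta> :: 'a
  where "\<theta> \<equiv> highest_root \<Phi> \<Delta>"

abbreviation h :: nat
  where "h \<equiv> coxeter_number \<Phi> \<Delta>"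

text \<open>The root lattice. It is also the coroot lattice, since every root is its own
  coroot.\<close>

abbreviation Q :: "'a set"
  where "Q \<equiv> group_closure \<Phi>"

lemma no_orthogonal_splitting:
  assumes "A \<noteq> {}" "B \<noteq> {}" "A \<union> B = \<Phi>" "A \<inter> B = {}"
    and "\<And>\<alpha> \<beta>. \<alpha> \<in> A \<Longrightarrow> \<beta> \<in> B \<Longrightarrow> \<alpha> \<bullet> \<beta> = 0"
  shows False
proof -
  have "\<exists>A B. A \<noteq> {} \<and> B \<noteq> {} \<and> A \<union> B = \<Phi> \<and> A \<inter> B = {} \<and> (\<forall>\<alpha>\<in>A. \<forall>\<beta>\<in>B. \<alpha> \<bullet> \<beta> = 0)"
    using assms by (intro exI[of _ A] exI[of _ B]) simp
  then show False
    using irreducible by (simp add: irreducible_root_system_def)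
qed

lemma inner_lattice_root_Ints: "x \<in> Q \<Longrightarrow> \<alpha> \<in> \<Phi> \<Longrightarrow> x \<bullet> \<alpha> \<in> \<int>"
  by (induction rule: group_closure.induct)
    (auto simp: inner_roots_Ints inner_diff_left intro: Ints_diff)

lemma inner_lattice_Ints: "y \<in> Q \<Longrightarrow> x \<in> Q \<Longrightarrow> x \<bullet> y \<in> \<int>"
  by (induction rule: group_closure.induct)
    (auto simp: inner_lattice_root_Ints inner_diff_right intro: Ints_diff)

text \<open>The generators have square 2, and a difference adds the cross term
  \<open>2 * (s \<bullet> t)\<close> with \<open>s \<bullet> t\<close> an integer.\<close>

lemma lattice_even: "x \<in> Q \<Longrightarrow> \<exists>k::int. x \<bullet> x = 2 * of_int k"
proof (induction rule: group_closure.induct)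
  case (base s)
  then show ?case
    by (auto simp: inner_root_self intro: exI[of _ 0] exI[of _ 1])
next
  case (diff s t)
  obtain k l m :: int where "s \<bullet> s = 2 * of_int k" "t \<bullet> t = 2 * of_int l" "s \<bullet> t = of_int m"
    using diff inner_lattice_Ints by (metis Ints_cases)
  then have "(s - t) \<bullet> (s - t) = 2 * of_int (k + l - m)"
    by (simp add: inner_diff_left inner_diff_right inner_commute)
  then show ?case
    by blast
qed

lemma root_in_lattice: "\<alpha> \<in> \<Phi> \<Longrightarrow> \<alpha> \<in> Q"
  by (simp add: group_closure.base)

lemma lattice_scale:
  assumes "x \<in> Q"
  shows "of_int k *\<^sub>R x \<in> Q"
proof -
  have "of_nat n *\<^sub>R x \<in> Q" for n
    by (induction n) (auto simp: algebra_simps intro: group_closure_add assms)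
  then show ?thesis
    by (cases k rule: int_cases2) simp_all
qed

lemma lattice_sum: "(\<And>i. i \<in> A \<Longrightarrow> f i \<in> Q) \<Longrightarrow> sum f A \<in> Q"
  by (induction A rule: infinite_finite_induct) (auto intro: group_closure_add)

lemma part_in_lattice:
  assumes "\<alpha> \<in> \<Phi>" "A \<subseteq> \<Delta>"
  shows "(\<Sum>\<delta>\<in>A. coef \<alpha> \<delta> *\<^sub>R \<delta>) \<in> Q"
proof (rule lattice_sum)
  fix \<delta> assume "\<delta> \<in> A"
  then have "\<delta> \<in> \<Delta>"
    using assms by blast
  then obtain k where "coef \<alpha> \<delta> = of_int k"
    using coef_root_Ints[OF assms(1)] by (metis Ints_cases)
  then show "coef \<alpha> \<delta> *\<^sub>R \<delta> \<in> Q"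
    using lattice_scale root_in_lattice simple_in_roots \<open>\<delta> \<in> \<Delta>\<close> by metis
qed

text \<open>An orthogonal splitting of the simple roots splits every root \<open>\<alpha>\<close> as \<open>a + b\<close> with
  \<open>2 = a \<bullet> a + b \<bullet> b\<close>; both summands are even, so one of them vanishes.\<close>

lemma simple_connected:
  assumes AB: "A \<union> B = \<Delta>" "A \<inter> B = {}"
    and orth: "\<And>\<alpha> \<beta>. \<alpha> \<in> A \<Longrightarrow> \<beta> \<in> B \<Longrightarrow> \<alpha> \<bullet> \<beta> = 0"
    and ne: "A \<noteq> {}" "B \<noteq> {}"
  shows False
proof -
  define p where "p C x = (\<Sum>\<delta>\<in>C. coef x \<delta> *\<^sub>R \<delta>)" for C x
  have fin: "finite A" "finite B"
    using AB finite_simple by (auto intro: finite_subset)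
  have split: "x = p A x + p B x" for x
    unfolding p_def using AB fin sum_coef[of x] by (simp add: sum.union_disjoint[symmetric])
  have pzero: "p C x \<bullet> y = 0" if "\<And>\<delta>. \<delta> \<in> C \<Longrightarrow> \<delta> \<bullet> y = 0" for C x y
    using that by (simp add: p_def inner_sum_left)
  have pp: "p A x \<bullet> p B y = 0" for x y
    using orth by (intro pzero) (simp add: p_def inner_sum_right)
  define A' where "A' = {\<alpha>\<in>\<Phi>. p B \<alpha> = 0}"
  define B' where "B' = {\<alpha>\<in>\<Phi>. p A \<alpha> = 0}"
  have cover: "A' \<union> B' = \<Phi>"
  proof -
    have "p A \<alpha> = 0 \<or> p B \<alpha> = 0" if "\<alpha> \<in> \<Phi>" for \<alpha>
    proof -
      have "p A \<alpha> \<in> Q" "p B \<alpha> \<in> Q"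
        using AB part_in_lattice[OF that] unfolding p_def by blast+
      then obtain k l :: int
        where kl: "p A \<alpha> \<bullet> p A \<alpha> = 2 * of_int k" "p B \<alpha> \<bullet> p B \<alpha> = 2 * of_int l"
        using lattice_even by metis
      have "\<alpha> \<bullet> \<alpha> = (p A \<alpha> + p B \<alpha>) \<bullet> (p A \<alpha> + p B \<alpha>)"
        using split[of \<alpha>] by simp
      also have "\<dots> = p A \<alpha> \<bullet> p A \<alpha> + p B \<alpha> \<bullet> p B \<alpha>"
        using pp[of \<alpha> \<alpha>] by (simp add: inner_add_left inner_add_right inner_commute)
      finally have "2 = 2 * real_of_int k + 2 * real_of_int l"
        using inner_root_self[OF that] kl by simp
      then have "k + l = 1"
        by linarith
      moreover have "k \<ge> 0" "l \<ge> 0"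
        using kl inner_ge_zero[of "p A \<alpha>"] inner_ge_zero[of "p B \<alpha>"] by auto
      ultimately have "k = 0 \<or> l = 0"
        by linarith
      then show ?thesis
        using kl by auto
    qed
    then show ?thesis
      by (auto simp: A'_def B'_def)
  qed
  have disj: "A' \<inter> B' = {}"
  proof -
    have "\<alpha> = 0" if "p A \<alpha> = 0" "p B \<alpha> = 0" for \<alpha>
      using split[of \<alpha>] that by simp
    then show ?thesis
      using inner_root_self by (force simp: A'_def B'_def)
  qed
  have orth': "\<alpha> \<bullet> \<beta> = 0" if "\<alpha> \<in> A'" "\<beta> \<in> B'" for \<alpha> \<beta>
    using split[of \<alpha>] split[of \<beta>] pp[of \<alpha> \<beta>] that by (simp add: A'_def B'_def)
  have p_other: "p C \<gamma> = 0" if "\<gamma> \<in> \<Delta>" "\<gamma> \<notin> C" for C \<gamma>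
    unfolding p_def using that by (intro sum.neutral) (auto simp: coef_simple)
  have "A \<subseteq> A'" "B \<subseteq> B'"
    unfolding A'_def B'_def using AB simple_in_roots p_other by blast+
  with ne have "A' \<noteq> {}" "B' \<noteq> {}"
    by auto
  then show False
    using no_orthogonal_splitting[OF _ _ cover disj orth'] by blast
qed

text \<open>Inner product 1 would make \<gamma> - \<delta> a root of height 0, but positive roots
  have height at least 1 and negative ones at most -1.\<close>

lemma inner_simple_nonpos:
  assumes "\<gamma> \<in> \<Delta>" "\<delta> \<in> \<Delta>" "\<gamma> \<noteq> \<delta>"
  shows "\<gamma> \<bullet> \<delta> \<le> 0"
proof -
  have r: "\<gamma> \<in> \<Phi>" "\<delta> \<in> \<Phi>"
    using assms simple_in_roots by auto
  have "\<gamma> - \<delta> \<notin> \<Phi>"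
  proof
    assume d: "\<gamma> - \<delta> \<in> \<Phi>"
    have "(\<gamma> - \<delta>) \<bullet> \<rho> = 0" "(\<delta> - \<gamma>) \<bullet> \<rho> = 0"
      using assms by (simp_all add: inner_diff_left rho_simple)
    then show False
      using pos_or_neg[OF d] inner_rho_pos[of "\<gamma> - \<delta>"] inner_rho_pos[of "\<delta> - \<gamma>"] by auto
  qed
  then show ?thesis
    using root_diff[OF r] assms(3) inner_root_self[OF r(2)]
    by (cases rule: inner_roots_cases[OF r]) auto
qed

lemma inner_simple_neg_cases:
  assumes "\<beta> \<in> \<Phi>" "\<delta> \<in> \<Delta>" "\<beta> \<bullet> \<delta> < 0"
  shows "\<beta> = - \<delta> \<or> \<beta> + \<delta> \<in> \<Phi>"
proof -
  have d: "\<delta> \<in> \<Phi>"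
    using assms simple_in_roots by auto
  show ?thesis
    by (rule inner_roots_cases[OF assms(1) d]) (use assms root_add d inner_root_self in auto)
qed

text \<open>Adding a simple root cannot keep \<open>t\<close> inside the root system, which makes
  \<open>t\<close> dominant. Connectedness of the simple roots gives \<open>t\<close> full support,
  and then every other root can be climbed up to \<open>t\<close>.\<close>

lemma max_height_dominates:
  assumes t: "t \<in> \<Phi>" and max: "\<And>\<beta>. \<beta> \<in> \<Phi> \<Longrightarrow> \<beta> \<bullet> \<rho> \<le> t \<bullet> \<rho>"
  shows "\<And>\<delta>. \<delta> \<in> \<Delta> \<Longrightarrow> t \<bullet> \<delta> \<ge> 0"
    and "\<And>\<delta>. \<delta> \<in> \<Delta> \<Longrightarrow> coef t \<delta> > 0"
    and "\<And>\<beta> \<delta>. \<beta> \<in> \<Phi> \<Longrightarrow> \<delta> \<in> \<Delta> \<Longrightarrow> coef \<beta> \<delta> \<le> coef t \<delta>"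
proof -
  have "- t \<bullet> \<rho> \<le> t \<bullet> \<rho>"
    using max uminus_root[OF t] by blast
  then have tp: "t \<in> pos"
    using pos_or_neg[OF t] inner_rho_pos[of "- t"] by auto
  show dom: "t \<bullet> \<delta> \<ge> 0" if "\<delta> \<in> \<Delta>" for \<delta>
  proof (rule ccontr)
    assume "\<not> ?thesis"
    then have "t = - \<delta> \<or> t + \<delta> \<in> \<Phi>"
      using inner_simple_neg_cases[OF t that] by auto
    then show False
      using max[of "t + \<delta>"] rho_simple[OF that] inner_rho_pos[OF tp]
      by (auto simp: inner_add_left)
  qed
  \<comment> \<open>For \<beta> outside the support, \<open>t \<bullet> \<beta>\<close> is a sum of
    nonpositive terms and yet nonnegative, so every term vanishes. The support would thus be
    orthogonal to its complement in \<Delta>.\<close>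
  have full: "coef t \<delta> \<noteq> 0" if "\<delta> \<in> \<Delta>" for \<delta>
  proof
    assume "coef t \<delta> = 0"
    let ?A = "{\<gamma>\<in>\<Delta>. coef t \<gamma> \<noteq> 0}" and ?B = "{\<gamma>\<in>\<Delta>. coef t \<gamma> = 0}"
    show False
    proof (rule simple_connected)
      show "?A \<union> ?B = \<Delta>" "?A \<inter> ?B = {}" "?B \<noteq> {}"
        using \<open>coef t \<delta> = 0\<close> that by auto
      show "?A \<noteq> {}"
      proof
        assume "?A = {}"
        then have "t = 0"
          by (intro coef_eqI) (auto simp: real_vector.representation_zero)
        then show False
          using inner_root_self[OF t] by simp
      qed
      fix \<alpha> \<beta> assume a: "\<alpha> \<in> ?A" and b: "\<beta> \<in> ?B"
      have le: "coef t \<gamma> * (\<gamma> \<bullet> \<beta>) \<le> 0" if "\<gamma> \<in> \<Delta>" for \<gamma>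
        using b that coef_pos_nonneg[OF tp that] inner_simple_nonpos[of \<gamma> \<beta>]
        by (cases "\<gamma> = \<beta>") (auto simp: mult_le_0_iff)
      have "(\<Sum>\<gamma>\<in>\<Delta>. - (coef t \<gamma> * (\<gamma> \<bullet> \<beta>))) \<le> 0"
        using dom[of \<beta>] b by (simp add: inner_coef[of t] sum_negf)
      then have "(\<Sum>\<gamma>\<in>\<Delta>. - (coef t \<gamma> * (\<gamma> \<bullet> \<beta>))) = 0"
        using le by (intro antisym sum_nonneg) auto
      then have "\<forall>\<gamma>\<in>\<Delta>. - (coef t \<gamma> * (\<gamma> \<bullet> \<beta>)) = 0"
        using le finite_simple by (subst (asm) sum_nonneg_eq_0_iff) auto
      then show "\<alpha> \<bullet> \<beta> = 0"
        using a by auto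
    qed
  qed
  show cpos: "coef t \<delta> > 0" if "\<delta> \<in> \<Delta>" for \<delta>
    using full[OF that] coef_pos_nonneg[OF tp that] by simp
  show "coef \<beta> \<delta> \<le> coef t \<delta>" if "\<beta> \<in> \<Phi>" "\<delta> \<in> \<Delta>" for \<beta> \<delta>
    using that(1)
  \<comment> \<open>Induction on the height gap to \<open>t\<close>: adding a simple root that pairs
    negatively with \<beta> closes the gap by 1 and lowers no coefficient.\<close>
  proof (induction \<beta> rule: measure_induct_rule[where f = "\<lambda>\<beta>. nat \<lfloor>(t - \<beta>) \<bullet> \<rho>\<rfloor>"])
    case (less \<beta>)
    show ?case
    proof (cases "\<exists>\<gamma>\<in>\<Delta>. \<beta> \<bullet> \<gamma> < 0")
      case True
      then obtain \<gamma> where g: "\<gamma> \<in> \<Delta>" "\<beta> \<bullet> \<gamma> < 0"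
        by blast
      consider "\<beta> = - \<gamma>" | "\<beta> + \<gamma> \<in> \<Phi>"
        using inner_simple_neg_cases[OF less.prems g] by blast
      then show ?thesis
      proof cases
        case 1
        then show ?thesis
          using cpos[OF that(2)] g(1) by (auto simp: coef_uminus coef_simple)
      next
        case 2
        have "(t - (\<beta> + \<gamma>)) \<bullet> \<rho> = (t - \<beta>) \<bullet> \<rho> - 1"
          by (simp add: inner_diff_left inner_add_left rho_simple g)
        moreover have "(t - (\<beta> + \<gamma>)) \<bullet> \<rho> \<ge> 0"
          using max[OF 2] by (simp add: inner_diff_left)
        ultimately have "nat \<lfloor>(t - (\<beta> + \<gamma>)) \<bullet> \<rho>\<rfloor> < nat \<lfloor>(t - \<beta>) \<bullet> \<rho>\<rfloor>"
          by linarith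
        then have "coef (\<beta> + \<gamma>) \<delta> \<le> coef t \<delta>"
          using less.IH 2 by blast
        then show ?thesis
          using coef_pos_nonneg[OF simple_pos[OF g(1)] that(2)] by (simp add: coef_add)
      qed
    next
      \<comment> \<open>A dominant \<beta> pairs positively with \<open>t\<close>, which has full
        support. So \<beta> is \<open>t\<close>, or \<open>t - \<beta>\<close> is a root, and
        maximality of the height of \<open>t\<close> makes that root positive.\<close>
      case False
      then have nn: "\<gamma> \<bullet> \<beta> \<ge> 0" if "\<gamma> \<in> \<Delta>" for \<gamma>
        using that by (force simp: inner_commute)
      have "t \<bullet> \<beta> \<noteq> 0"
      proof
        assume "t \<bullet> \<beta> = 0"
        then have "(\<Sum>\<gamma>\<in>\<Delta>. coef t \<gamma> * (\<gamma> \<bullet> \<beta>)) = 0"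
          by (simp add: inner_coef[of t])
        then have "\<forall>\<gamma>\<in>\<Delta>. coef t \<gamma> * (\<gamma> \<bullet> \<beta>) = 0"
          using nn cpos finite_simple by (subst (asm) sum_nonneg_eq_0_iff) (auto simp: less_imp_le)
        then have "\<beta> = 0"
          using full by (intro inner_simple_eqI) (auto simp: inner_commute)
        then show False
          using inner_root_self[OF less.prems] by simp
      qed
      moreover have "t \<bullet> \<beta> \<ge> 0"
        unfolding inner_coef[of t] using nn cpos by (intro sum_nonneg) (auto simp: less_imp_le)
      ultimately have gt: "t \<bullet> \<beta> > 0"
        by simp
      then consider "t \<bullet> \<beta> = 1" | "t = \<beta>"
        using inner_root_self[OF less.prems] by (cases rule: inner_roots_cases[OF t less.prems]) auto
      then show ?thesis
      proof cases
        case 1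
        then have d: "t - \<beta> \<in> \<Phi>"
          using root_diff[OF t less.prems] by simp
        have "\<not> - (t - \<beta>) \<in> pos"
          using inner_rho_pos[of "- (t - \<beta>)"] max[OF less.prems] by (auto simp: inner_diff_left)
        then have "t - \<beta> \<in> pos"
          using pos_or_neg[OF d] by blast
        then show ?thesis
          using coef_pos_nonneg[of "t - \<beta>" \<delta>] that by (simp add: coef_diff)
      qed simp
    qed
  qed
qed

text \<open>Finiteness provides a root of maximal height. Since it dominates all roots
  coefficientwise, it is the only such root, so the definite description is well defined.\<close>

lemma
  shows highest_root_in_roots: "\<theta> \<in> \<Phi>"
    and coef_le_highest: "\<And>\<beta> \<delta>. \<beta> \<in> \<Phi> \<Longrightarrow> \<delta> \<in> \<Delta> \<Longrightarrow> coef \<beta> \<delta> \<le> coef \<theta> \<delta>"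
proof -
  have "\<Phi> \<noteq> {}"
    using irreducible by (simp add: irreducible_root_system_def)
  then have "Max ((\<lambda>\<alpha>. \<alpha> \<bullet> \<rho>) ` \<Phi>) \<in> (\<lambda>\<alpha>. \<alpha> \<bullet> \<rho>) ` \<Phi>"
    using finite_roots by (intro Max_in) auto
  then obtain t where t: "t \<in> \<Phi>" "t \<bullet> \<rho> = Max ((\<lambda>\<alpha>. \<alpha> \<bullet> \<rho>) ` \<Phi>)"
    by auto
  then have "\<beta> \<bullet> \<rho> \<le> t \<bullet> \<rho>" if "\<beta> \<in> \<Phi>" for \<beta>
    using that finite_roots by simp
  note dom = max_height_dominates(3)[OF t(1) this]
  let ?P = "\<lambda>t. t \<in> \<Phi> \<and> (\<forall>\<beta>\<in>\<Phi>. \<forall>\<delta>\<in>\<Delta>. coef \<beta> \<delta> \<le> coef t \<delta>)"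
  have "?P t"
    using t dom by blast
  moreover have "u = t" if "?P u" for u
    using that dom t(1) by (intro coef_eqI antisym) auto
  ultimately have "?P \<theta>"
    unfolding highest_root_def by (rule theI)
  then show "\<theta> \<in> \<Phi>" "\<And>\<beta> \<delta>. \<beta> \<in> \<Phi> \<Longrightarrow> \<delta> \<in> \<Delta> \<Longrightarrow> coef \<beta> \<delta> \<le> coef \<theta> \<delta>"
    by blast+
qed

lemma inner_rho_le_highest: "\<beta> \<in> \<Phi> \<Longrightarrow> \<beta> \<bullet> \<rho> \<le> \<theta> \<bullet> \<rho>"
  unfolding height_eq_inner[symmetric] height_def by (intro sum_mono coef_le_highest)

lemma highest_root_dominant: "\<delta> \<in> \<Delta> \<Longrightarrow> \<theta> \<bullet> \<delta> \<ge> 0"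
  and coef_highest_pos: "\<delta> \<in> \<Delta> \<Longrightarrow> coef \<theta> \<delta> > 0"
  using max_height_dominates[OF highest_root_in_roots inner_rho_le_highest] by blast+

lemma highest_root_pos: "\<theta> \<in> pos"
  using coef_highest_pos highest_root_in_roots by (auto simp: positive_roots_def less_imp_le)

lemma inner_highest_rho: "\<theta> \<bullet> \<rho> = real h - 1"
proof -
  obtain k where "\<theta> \<bullet> \<rho> = of_int k"
    using inner_rho_Ints[OF highest_root_in_roots] by (metis Ints_cases)
  then show ?thesis
    using inner_rho_pos[OF highest_root_pos] by (simp add: coxeter_number_def height_eq_inner)
qed

lemma inner_rho_le: "\<beta> \<in> \<Phi> \<Longrightarrow> \<beta> \<bullet> \<rho> \<le> real h - 1"
  using inner_rho_le_highest inner_highest_rho by metis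

lemma abs_inner_rho_less: "\<beta> \<in> \<Phi> \<Longrightarrow> \<bar>\<beta> \<bullet> \<rho>\<bar> < real h"
  using inner_rho_le[of \<beta>] inner_rho_le[of "- \<beta>"] uminus_root[of \<beta>] by auto

lemma coxeter_number_ge_2: "h \<ge> 2"
  using inner_highest_rho inner_rho_pos[OF highest_root_pos] by simp

lemma dual_coxeter_number_eq: "dual_coxeter_number \<Phi> \<Delta> = h"
proof -
  have "coroot ` \<Delta> = \<Delta>"
    using coroot_root simple_in_roots by (simp add: image_cong[of _ _ coroot id])
  then show ?thesis
    by (simp add: dual_coxeter_number_def coxeter_number_def coroot_root highest_root_in_roots)
qed

subsection \<open>The strange formula\<close>

lemma sum_roots_even:
  fixes f :: "'a \<Rightarrow> real"
  assumes "\<And>\<alpha>. f (- \<alpha>) = f \<alpha>"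
  shows "sum f \<Phi> = 2 * sum f pos"
proof -
  have "\<Phi> = pos \<union> uminus ` pos"
    using pos_or_neg pos_in_roots uminus_root
    by (auto simp: image_iff) (metis minus_minus)
  moreover have "pos \<inter> uminus ` pos = {}"
    using pos_not_neg by auto
  ultimately have "sum f \<Phi> = sum f pos + sum f (uminus ` pos)"
    using finite_pos by (metis finite_imageI sum.union_disjoint)
  also have "sum f (uminus ` pos) = sum f pos"
    by (subst sum.reindex) (auto simp: assms)
  finally show ?thesis
    by simp
qed

text \<open>The symmetric operator belonging to the Weyl-invariant form that sums
  \<open>(\<alpha> \<bullet> x) * (\<alpha> \<bullet> y)\<close> over all roots. A Schur-type
  argument will show that it is scalar.\<close>

definition root_operator :: "'a \<Rightarrow> 'a"
  where "root_operator x = (\<Sum>\<alpha>\<in>\<Phi>. (\<alpha> \<bullet> x) *\<^sub>R \<alpha>)"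

lemma linear_root_operator: "linear root_operator"
  unfolding root_operator_def
  by (rule linearI)
    (simp_all add: inner_add_right scaleR_add_left sum.distrib scaleR_sum_right)

lemma root_operator_inner: "root_operator x \<bullet> y = (\<Sum>\<alpha>\<in>\<Phi>. (\<alpha> \<bullet> x) * (\<alpha> \<bullet> y))"
  by (simp add: root_operator_def inner_sum_left)

lemma bij_betw_reflection: "\<beta> \<in> \<Phi> \<Longrightarrow> bij_betw (reflection \<beta>) \<Phi> \<Phi>"
  by (rule bij_betw_byWitness[where f' = "reflection \<beta>"])
    (auto simp: reflection_reflection reflection_in_roots)

lemma root_operator_reflection:
  assumes "\<beta> \<in> \<Phi>"
  shows "root_operator (reflection \<beta> x) = reflection \<beta> (root_operator x)"
proof -
  have "root_operator (reflection \<beta> x) =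
      (\<Sum>\<alpha>\<in>\<Phi>. (reflection \<beta> \<alpha> \<bullet> reflection \<beta> x) *\<^sub>R reflection \<beta> \<alpha>)"
    unfolding root_operator_def
    by (rule sum.reindex_bij_betw[OF bij_betw_reflection[OF assms], symmetric])
  also have "\<dots> = reflection \<beta> (root_operator x)"
    unfolding root_operator_def
    by (simp add: inner_reflection[OF assms] linear_sum[OF linear_reflection]
        linear_scale[OF linear_reflection])
  finally show ?thesis .
qed

text \<open>The operator commutes with the reflection in \<beta>, so it preserves the eigenspace for
  -1, which is the line through \<beta>.\<close>

lemma root_operator_root:
  assumes "\<beta> \<in> \<Phi>"
  shows "root_operator \<beta> = ((root_operator \<beta> \<bullet> \<beta>) / 2) *\<^sub>R \<beta>"
proof -
  have "- root_operator \<beta> = root_operator (reflection \<beta> \<beta>)"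
    using assms linear_neg[OF linear_root_operator, of \<beta>]
    by (simp add: reflection_root inner_root_self scaleR_2)
  also have "\<dots> = root_operator \<beta> - (root_operator \<beta> \<bullet> \<beta>) *\<^sub>R \<beta>"
    by (simp add: root_operator_reflection[OF assms] reflection_root[OF assms, of "root_operator \<beta>"])
  finally have "2 *\<^sub>R root_operator \<beta> = (root_operator \<beta> \<bullet> \<beta>) *\<^sub>R \<beta>"
    by (simp add: scaleR_2 algebra_simps)
  then have "(1/2) *\<^sub>R (2 *\<^sub>R root_operator \<beta>) = (1/2) *\<^sub>R ((root_operator \<beta> \<bullet> \<beta>) *\<^sub>R \<beta>)"
    by simp
  then show ?thesis
    by simp
qed

lemma sum_pos_inner: "(\<Sum>\<alpha>\<in>pos. \<alpha> \<bullet> x) = 2 * (\<rho> \<bullet> x)"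
proof -
  have "\<rho> = (1/2) *\<^sub>R \<Sum>pos"
    using weyl_vector_eq_covector by (simp add: weyl_vector_def)
  then show ?thesis
    by (simp add: inner_sum_left)
qed

text \<open>Positive roots other than \<theta> pair with \<theta> to 0 or 1, where squaring changes
  nothing; \<theta> itself gives 4 instead of 2. Hence the squares over positive roots sum to
  \<open>2 * (h - 1) + 2\<close>, and the negative roots double this.\<close>

lemma root_operator_highest: "root_operator \<theta> \<bullet> \<theta> = 4 * real h"
proof -
  have t: "\<theta> \<in> \<Phi>" and tp: "\<theta> \<in> pos"
    by (simp_all add: highest_root_in_roots highest_root_pos)
  have "(\<alpha> \<bullet> \<theta>)\<^sup>2 = \<alpha> \<bullet> \<theta>" if "\<alpha> \<in> pos - {\<theta>}" for \<alpha>
  proof -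
    have nn: "\<alpha> \<bullet> \<theta> \<ge> 0"
      unfolding inner_coef[of \<alpha>] using highest_root_dominant coef_pos_nonneg that
      by (intro sum_nonneg) (auto simp: inner_commute)
    have r: "\<alpha> \<in> \<Phi>"
      using that pos_in_roots by auto
    show ?thesis
      by (cases rule: inner_roots_cases[OF r t]) (use that nn inner_root_self[OF t] in auto)
  qed
  then have "(\<Sum>\<alpha>\<in>pos - {\<theta>}. (\<alpha> \<bullet> \<theta>)\<^sup>2) = (\<Sum>\<alpha>\<in>pos - {\<theta>}. \<alpha> \<bullet> \<theta>)"
    by simp
  then have "(\<Sum>\<alpha>\<in>pos. (\<alpha> \<bullet> \<theta>)\<^sup>2) = (\<Sum>\<alpha>\<in>pos. \<alpha> \<bullet> \<theta>) + 2"
    using tp finite_pos by (simp add: sum.remove[of pos \<theta>] inner_root_self[OF t])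
  also have "\<dots> = 2 * real h"
    by (simp add: sum_pos_inner inner_commute[of \<rho>] inner_highest_rho)
  finally show ?thesis
    using sum_roots_even[of "\<lambda>\<alpha>. (\<alpha> \<bullet> \<theta>)\<^sup>2"]
    by (simp add: root_operator_inner power2_eq_square)
qed

text \<open>Eigenvalues at non-orthogonal roots coincide because the operator is symmetric.\<close>

lemma root_operator_eq: "root_operator x = (2 * real h) *\<^sub>R x"
proof -
  define m where "m \<beta> = (root_operator \<beta> \<bullet> \<beta>) / 2" for \<beta>
  have eigen: "root_operator \<beta> = m \<beta> *\<^sub>R \<beta>" if "\<beta> \<in> \<Phi>" for \<beta>
    using root_operator_root[OF that] by (simp add: m_def)
  have orth: "\<beta> \<bullet> \<gamma> = 0" if "\<beta> \<in> \<Phi>" "\<gamma> \<in> \<Phi>" "m \<beta> \<noteq> m \<gamma>" for \<beta> \<gamma>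
  proof -
    have "root_operator \<beta> \<bullet> \<gamma> = root_operator \<gamma> \<bullet> \<beta>"
      by (simp add: root_operator_inner mult.commute)
    then have "m \<beta> * (\<beta> \<bullet> \<gamma>) = m \<gamma> * (\<beta> \<bullet> \<gamma>)"
      using eigen that by (simp add: inner_commute)
    then show ?thesis
      using that by simp
  qed
  have "m \<beta> = m \<theta>" if "\<beta> \<in> \<Phi>" for \<beta>
  proof (rule ccontr)
    assume "m \<beta> \<noteq> m \<theta>"
    let ?A = "{\<alpha>\<in>\<Phi>. m \<alpha> = m \<theta>}" and ?B = "{\<alpha>\<in>\<Phi>. m \<alpha> \<noteq> m \<theta>}"
    have "?A \<noteq> {}" "?B \<noteq> {}" "?A \<union> ?B = \<Phi>" "?A \<inter> ?B = {}"
      using \<open>m \<beta> \<noteq> m \<theta>\<close> that highest_root_in_roots by auto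
    then show False
      by (rule no_orthogonal_splitting) (auto intro: orth)
  qed
  moreover have "m \<theta> = 2 * real h"
    by (simp add: m_def root_operator_highest)
  ultimately have "\<And>\<beta>. \<beta> \<in> \<Phi> \<Longrightarrow> root_operator \<beta> = (2 * real h) *\<^sub>R \<beta>"
    using eigen by simp
  moreover have "linear (\<lambda>x::'a. (2 * real h) *\<^sub>R x)"
    by (rule linearI) (simp_all add: scaleR_add_right)
  ultimately show ?thesis
    using linear_eq_on_span[OF linear_root_operator] span_roots by blast
qed

lemma sum_pos_inner_squared: "(\<Sum>\<alpha>\<in>pos. (\<alpha> \<bullet> x)\<^sup>2) = real h * (x \<bullet> x)"
  using sum_roots_even[of "\<lambda>\<alpha>. (\<alpha> \<bullet> x)\<^sup>2"] root_operator_inner[of x x]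
  by (simp add: root_operator_eq power2_eq_square)

text \<open>Trace of the quadratic form: \<open>sum_pos_inner_squared\<close> is summed over an
  orthonormal basis, and each root contributes its squared length 2.\<close>

lemma card_pos: "2 * real (card pos) = real h * real DIM('a)"
proof -
  have "real h * real DIM('a) = (\<Sum>e\<in>(Basis::'a set). real h * (e \<bullet> e))"
    by simp
  also have "\<dots> = (\<Sum>\<alpha>\<in>pos. \<Sum>e\<in>Basis. (\<alpha> \<bullet> e)\<^sup>2)"
    by (subst sum.swap) (simp add: sum_pos_inner_squared)
  also have "\<dots> = (\<Sum>\<alpha>\<in>pos. 2)"
  proof (rule sum.cong)
    fix \<alpha> assume "\<alpha> \<in> pos"
    then show "(\<Sum>e\<in>Basis. (\<alpha> \<bullet> e)\<^sup>2) = 2"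
      using inner_root_self[of \<alpha>] pos_in_roots euclidean_inner[of \<alpha> \<alpha>]
      by (simp add: power2_eq_square)
  qed simp
  finally show ?thesis
    by simp
qed

section \<open>Counting pairs of positive roots by their inner product\<close>

definition pos_pairs :: "real \<Rightarrow> ('a \<times> 'a) set"
  where "pos_pairs c = {(\<alpha>, \<beta>) \<in> pos \<times> pos. \<alpha> \<bullet> \<beta> = c}"

lemma finite_pos_pairs: "finite (pos_pairs c)"
  by (rule finite_subset[of _ "pos \<times> pos"]) (auto simp: pos_pairs_def finite_pos)

text \<open>Both counts come from the rank two subsystems of type \<open>A\<^sub>2\<close>: among the positive roots
  \<open>\<alpha>, \<beta>, \<alpha> + \<beta>\<close> one unordered pair has inner product \<open>-1\<close> and two have \<open>1\<close>.\<close>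

lemma card_pos_pairs: "card (pos_pairs 1) = 2 * card (pos_pairs (-1))"
proof -
  let ?A = "{(\<alpha>, \<beta>) \<in> pos_pairs 1. \<alpha> - \<beta> \<in> pos}"
  let ?B = "{(\<alpha>, \<beta>) \<in> pos_pairs 1. \<beta> - \<alpha> \<in> pos}"
  have union: "pos_pairs 1 = ?A \<union> ?B"
  proof -
    have "\<alpha> - \<beta> \<in> pos \<or> \<beta> - \<alpha> \<in> pos" if "(\<alpha>, \<beta>) \<in> pos_pairs 1" for \<alpha> \<beta>
      using that root_diff[of \<alpha> \<beta>] pos_in_roots pos_or_neg[of "\<alpha> - \<beta>"]
      by (auto simp: pos_pairs_def)
    then show ?thesis
      by auto
  qed
  have disj: "?A \<inter> ?B = {}"
    using pos_not_neg by (fastforce simp: minus_diff_eq)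
  have "bij_betw (\<lambda>(\<alpha>, \<beta>). (\<beta>, \<alpha>)) ?A ?B"
    by (rule bij_betw_byWitness[where f' = "\<lambda>(\<alpha>, \<beta>). (\<beta>, \<alpha>)"])
      (auto simp: pos_pairs_def inner_commute)
  then have "card ?B = card ?A"
    by (simp add: bij_betw_same_card)
  \<comment> \<open>Since \<open>\<beta> \<bullet> \<beta> = 2\<close>, adding \<beta> to the first
    entry raises the inner product from -1 to 1.\<close>
  moreover have "bij_betw (\<lambda>(\<alpha>, \<beta>). (\<alpha> + \<beta>, \<beta>)) (pos_pairs (-1)) ?A"
  proof (rule bij_betw_byWitness[where f' = "\<lambda>(\<alpha>, \<beta>). (\<alpha> - \<beta>, \<beta>)"])
    have "(\<alpha> + \<beta>, \<beta>) \<in> ?A" if "(\<alpha>, \<beta>) \<in> pos_pairs (-1)" for \<alpha> \<beta>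
    proof -
      have ab: "\<alpha> \<in> pos" "\<beta> \<in> pos" "\<alpha> \<bullet> \<beta> = -1"
        using that by (auto simp: pos_pairs_def)
      then have r: "\<alpha> + \<beta> \<in> \<Phi>"
        using root_add pos_in_roots by blast
      then have "\<alpha> + \<beta> \<in> pos"
        using inner_rho_pos[OF ab(1)] inner_rho_pos[OF ab(2)]
        by (simp add: pos_iff_inner_rho inner_add_left)
      then show ?thesis
        using ab inner_root_self[OF pos_in_roots[OF ab(2)]]
        by (simp add: pos_pairs_def inner_add_left)
    qed
    then show "(\<lambda>(\<alpha>, \<beta>). (\<alpha> + \<beta>, \<beta>)) ` pos_pairs (-1) \<subseteq> ?A"
      by force
    show "(\<lambda>(\<alpha>, \<beta>). (\<alpha> - \<beta>, \<beta>)) ` ?A \<subseteq> pos_pairs (-1)"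
      using inner_root_self pos_in_roots by (auto simp: pos_pairs_def inner_diff_left)
  qed auto
  then have "card ?A = card (pos_pairs (-1))"
    by (simp add: bij_betw_same_card)
  moreover have "card ?A + card ?B = card (?A \<union> ?B)"
    using finite_pos_pairs[of 1] disj
    by (intro card_Un_disjoint[symmetric]) (auto intro: rev_finite_subset)
  moreover have "\<dots> = card (pos_pairs 1)"
    by (rule arg_cong[OF union[symmetric]])
  ultimately show ?thesis
    by simp
qed

text \<open>Two positive roots are never opposite, so only 2, 1, 0 and -1 occur as inner products.
  The value 2 belongs to the diagonal, and \<open>f 0 = 0\<close> discards orthogonal pairs.\<close>

lemma sum_pos_pairs:
  fixes f :: "real \<Rightarrow> real"
  assumes "f 0 = 0"
  shows "(\<Sum>\<alpha>\<in>pos. \<Sum>\<beta>\<in>pos. f (\<alpha> \<bullet> \<beta>)) =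
    f 2 * card pos + f 1 * card (pos_pairs 1) + f (-1) * card (pos_pairs (-1))"
proof -
  let ?P = "pos \<times> pos"
  let ?g = "\<lambda>c p. f c * (of_bool (fst p \<bullet> snd p = c) :: real)"
  have count: "(\<Sum>p\<in>?P. ?g c p) = f c * card (pos_pairs c)" for c
  proof -
    have "?P \<inter> {p. fst p \<bullet> snd p = c} = pos_pairs c"
      by (auto simp: pos_pairs_def)
    then show ?thesis
      using finite_pos by (simp add: sum_distrib_left[symmetric] sum_of_bool_eq)
  qed
  have "pos_pairs 2 = (\<lambda>\<alpha>. (\<alpha>, \<alpha>)) ` pos"
  proof -
    have "\<alpha> = \<beta>" if "\<alpha> \<in> pos" "\<beta> \<in> pos" "\<alpha> \<bullet> \<beta> = 2" for \<alpha> \<beta>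
      using root_eq_if_inner_2[of \<alpha> \<beta>] that pos_in_roots by simp
    then show ?thesis
      using inner_root_self pos_in_roots by (auto simp: pos_pairs_def)
  qed
  then have diag: "card (pos_pairs 2) = card pos"
    by (simp add: card_image inj_on_def)
  have "(\<Sum>\<alpha>\<in>pos. \<Sum>\<beta>\<in>pos. f (\<alpha> \<bullet> \<beta>)) = (\<Sum>p\<in>?P. f (fst p \<bullet> snd p))"
    by (simp add: sum.cartesian_product split_def)
  also have "\<dots> = (\<Sum>p\<in>?P. ?g 2 p + ?g 1 p + ?g (-1) p)"
  proof (rule sum.cong)
    fix p assume p: "p \<in> ?P"
    then have r: "fst p \<in> \<Phi>" "snd p \<in> \<Phi>"
      using pos_in_roots by auto
    have "fst p \<noteq> - snd p"
      using p pos_not_neg[of "snd p"] by (metis SigmaE fst_conv snd_conv)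
    then show "f (fst p \<bullet> snd p) = ?g 2 p + ?g 1 p + ?g (-1) p"
      by (cases rule: inner_roots_cases[OF r]) (use assms inner_root_self[OF r(2)] in simp_all)
  qed simp
  also have "\<dots> = f 2 * card pos + f 1 * card (pos_pairs 1) + f (-1) * card (pos_pairs (-1))"
    by (simp only: sum.distrib count diag)
  finally show ?thesis .
qed

text \<open>The double sums of \<open>\<alpha> \<bullet> \<beta>\<close> and of its square each have
  two evaluations. This gives two linear relations between \<open>\<rho> \<bullet> \<rho>\<close>,
  \<open>?N\<close> and \<open>?M\<close>.\<close>

lemma strange_formula: "12 * (\<rho> \<bullet> \<rho>) = real DIM('a) * real h * (real h + 1)"
proof -
  let ?N = "real (card pos)" and ?M = "real (card (pos_pairs (-1)))"
  have "(\<Sum>\<alpha>\<in>pos. \<Sum>\<beta>\<in>pos. \<alpha> \<bullet> \<beta>) = (\<Sum>\<alpha>\<in>pos. 2 * (\<alpha> \<bullet> \<rho>))"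
    by (intro sum.cong refl) (metis (no_types, lifting) inner_commute sum.cong sum_pos_inner)
  also have "\<dots> = 4 * (\<rho> \<bullet> \<rho>)"
    by (simp add: sum_distrib_left[symmetric] sum_pos_inner)
  finally have 1: "4 * (\<rho> \<bullet> \<rho>) = 2 * ?N + ?M"
    using sum_pos_pairs[of "\<lambda>c. c"] by (simp add: card_pos_pairs)
  have "(\<Sum>\<alpha>\<in>pos. \<Sum>\<beta>\<in>pos. (\<alpha> \<bullet> \<beta>)\<^sup>2) = (\<Sum>\<beta>\<in>pos. \<Sum>\<alpha>\<in>pos. (\<alpha> \<bullet> \<beta>)\<^sup>2)"
    by (rule sum.swap)
  also have "\<dots> = 2 * real h * ?N"
    by (simp add: sum_pos_inner_squared inner_root_self pos_in_roots)
  finally have 2: "2 * real h * ?N = 4 * ?N + 3 * ?M"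
    using sum_pos_pairs[of "\<lambda>c. c\<^sup>2"] by (simp add: card_pos_pairs)
  \<comment> \<open>Three times the first relation contains \<open>3 * ?M\<close>, which the second
    one replaces by \<open>2 * real h * ?N - 4 * ?N\<close>.\<close>
  have "12 * (\<rho> \<bullet> \<rho>) = 2 * ?N * (real h + 1)"
    using 1 2 by (simp add: algebra_simps)
  then show ?thesis
    using card_pos by (simp add: mult.commute)
qed

subsection \<open>Folding into the fundamental alcove\<close>

lemma weyl_linear: "w \<in> weyl_group \<Phi> \<Longrightarrow> linear w"
proof (induction rule: weyl_group.induct)
  case id
  show ?case
    by (rule linear_id)
next
  case (step w \<alpha>)
  then show ?case
    by (intro linear_compose linear_reflection)
qed

lemma weyl_inner: "w \<in> weyl_group \<Phi> \<Longrightarrow> w x \<bullet> w y = x \<bullet> y"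
  by (induction rule: weyl_group.induct) (auto simp: inner_reflection)

lemma weyl_root: "w \<in> weyl_group \<Phi> \<Longrightarrow> \<alpha> \<in> \<Phi> \<Longrightarrow> w \<alpha> \<in> \<Phi>"
  by (induction rule: weyl_group.induct) (auto simp: reflection_in_roots)

lemma weyl_comp: "v \<in> weyl_group \<Phi> \<Longrightarrow> w \<in> weyl_group \<Phi> \<Longrightarrow> v \<circ> w \<in> weyl_group \<Phi>"
  by (induction rule: weyl_group.induct) (auto simp: o_assoc[symmetric] intro: weyl_group.step)

lemma reflection_in_weyl: "\<alpha> \<in> \<Phi> \<Longrightarrow> reflection \<alpha> \<in> weyl_group \<Phi>"
  using weyl_group.step[OF weyl_group.id] by simp

text \<open>Each generator is an involution, so multiplying the same reflections in reverse order
  inverts \<open>w\<close>.\<close>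

lemma weyl_inverse:
  assumes "w \<in> weyl_group \<Phi>"
  obtains v where "v \<in> weyl_group \<Phi>" "\<And>x. v (w x) = x" "\<And>x. w (v x) = x"
proof -
  from assms have "\<exists>v\<in>weyl_group \<Phi>. (\<forall>x. v (w x) = x) \<and> (\<forall>x. w (v x) = x)"
  proof (induction rule: weyl_group.induct)
    case id
    then show ?case
      by (intro bexI[of _ id]) (auto intro: weyl_group.id)
  next
    case (step w \<alpha>)
    then obtain v where "v \<in> weyl_group \<Phi>" "\<And>x. v (w x) = x" "\<And>x. w (v x) = x"
      by blast
    then show ?case
      using step.hyps
      by (intro bexI[of _ "v \<circ> reflection \<alpha>"])
        (auto simp: reflection_reflection intro: weyl_comp reflection_in_weyl)
  qed
  then show thesis
    using that by blast
qed

lemma weyl_lattice: "x \<in> Q \<Longrightarrow> w \<in> weyl_group \<Phi> \<Longrightarrow> w x \<in> Q"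
  by (induction rule: group_closure.induct)
    (auto simp: linear_0[OF weyl_linear] linear_diff[OF weyl_linear] weyl_root root_in_lattice
      intro: group_closure.diff)

text \<open>The affine Weyl orbit of \<open>b\<close> \<rho> / \<open>h\<close>, scaled by
  \<open>h\<close> so that its points pair integrally with roots.\<close>

definition orbit :: "nat \<Rightarrow> 'a set"
  where "orbit b = {w (real b *\<^sub>R \<rho>) + real h *\<^sub>R q | w q. w \<in> weyl_group \<Phi> \<and> q \<in> Q}"

lemma orbit_translate: "z \<in> orbit b \<Longrightarrow> q \<in> Q \<Longrightarrow> z + real h *\<^sub>R q \<in> orbit b"
  unfolding orbit_def mem_Collect_eq
  by (metis add.assoc group_closure_add scaleR_add_right)

lemma orbit_reflection:
  assumes "z \<in> orbit b" "\<alpha> \<in> \<Phi>"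
  shows "reflection \<alpha> z \<in> orbit b"
proof -
  obtain w q where wq: "w \<in> weyl_group \<Phi>" "q \<in> Q" "z = w (real b *\<^sub>R \<rho>) + real h *\<^sub>R q"
    using assms(1) by (auto simp: orbit_def)
  have "reflection \<alpha> z = (reflection \<alpha> \<circ> w) (real b *\<^sub>R \<rho>) + real h *\<^sub>R reflection \<alpha> q"
    by (simp add: wq(3) linear_add[OF linear_reflection] linear_scale[OF linear_reflection])
  then show ?thesis
    unfolding orbit_def
    using weyl_group.step[OF wq(1) assms(2)] weyl_lattice[OF wq(2) reflection_in_weyl[OF assms(2)]]
    by blast
qed

text \<open>Modulo \<open>h\<close> the pairing is \<open>b\<close> times the height of a root. That
  height is nonzero and less than \<open>h\<close> in absolute value, so coprimality prevents
  divisibility: orbit points avoid all affine walls.\<close>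

lemma orbit_inner:
  assumes "z \<in> orbit b" "\<alpha> \<in> \<Phi>" "coprime b h"
  obtains k :: int where "z \<bullet> \<alpha> = of_int k" "\<not> int h dvd k"
proof -
  obtain w q where wq: "w \<in> weyl_group \<Phi>" "q \<in> Q" "z = w (real b *\<^sub>R \<rho>) + real h *\<^sub>R q"
    using assms(1) by (auto simp: orbit_def)
  obtain v where v: "v \<in> weyl_group \<Phi>" "\<And>x. v (w x) = x"
    using weyl_inverse[OF wq(1)] by metis
  let ?\<beta> = "v \<alpha>"
  have \<beta>: "?\<beta> \<in> \<Phi>"
    using weyl_root v(1) assms(2) by blast
  have "w \<rho> \<bullet> \<alpha> = \<rho> \<bullet> ?\<beta>"
    using weyl_inner[OF v(1), of "w \<rho>" \<alpha>] v(2) by simp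
  then have eq: "z \<bullet> \<alpha> = real b * (?\<beta> \<bullet> \<rho>) + real h * (q \<bullet> \<alpha>)"
    by (simp add: wq(3) inner_add_left inner_add_right linear_scale[OF weyl_linear[OF wq(1)]] inner_commute)
  obtain m where m: "?\<beta> \<bullet> \<rho> = of_int m"
    using inner_rho_Ints[OF \<beta>] by (metis Ints_cases)
  obtain l where l: "q \<bullet> \<alpha> = of_int l"
    using inner_lattice_root_Ints[OF wq(2) assms(2)] by (metis Ints_cases)
  have m0: "m \<noteq> 0"
    using pos_or_neg[OF \<beta>] inner_rho_pos[of ?\<beta>] inner_rho_pos[of "- ?\<beta>"] m by auto
  have "\<bar>real_of_int m\<bar> < real h"
    using abs_inner_rho_less[OF \<beta>] m by simp
  then have "\<bar>m\<bar> < int h"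
    by linarith
  then have ndvd: "\<not> int h dvd m"
    using m0 by (metis dvd_imp_le_int abs_of_nat not_less)
  show thesis
  proof (rule that[of "int b * m + int h * l"])
    show "z \<bullet> \<alpha> = of_int (int b * m + int h * l)"
      using eq m l by simp
    show "\<not> int h dvd int b * m + int h * l"
      using ndvd assms(3)
      by (metis coprime_commute coprime_dvd_mult_right_iff coprime_int_iff dvd_add_left_iff
          dvd_triv_left)
  qed
qed

text \<open>The simple coordinates of \<open>z\<close> are at least \<open>1\<close>, while their combination with the positive
  coefficients of \<open>\<theta>\<close> is at most \<open>h - 1\<close>, its value when all of them equal \<open>1\<close>.\<close>

lemma alcove_point_eq_rho:
  assumes ge: "\<And>\<delta>. \<delta> \<in> \<Delta> \<Longrightarrow> z \<bullet> \<delta> \<ge> 1" and le: "z \<bullet> \<theta> \<le> real h - 1"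
  shows "z = \<rho>"
proof (rule inner_simple_eqI)
  fix \<delta> assume d: "\<delta> \<in> \<Delta>"
  have nn: "coef \<theta> \<gamma> * (z \<bullet> \<gamma> - 1) \<ge> 0" if "\<gamma> \<in> \<Delta>" for \<gamma>
    using coef_highest_pos[OF that] ge[OF that] by simp
  have "(\<Sum>\<gamma>\<in>\<Delta>. coef \<theta> \<gamma> * (z \<bullet> \<gamma> - 1)) = \<theta> \<bullet> z - \<theta> \<bullet> \<rho>"
    by (simp add: inner_coef[of \<theta>] rho_simple inner_commute[of z] algebra_simps sum_subtractf)
  also have "\<dots> \<le> 0"
    using le inner_highest_rho by (simp add: inner_commute)
  finally have "(\<Sum>\<gamma>\<in>\<Delta>. coef \<theta> \<gamma> * (z \<bullet> \<gamma> - 1)) = 0"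
    using nn by (intro antisym sum_nonneg) auto
  then have "\<forall>\<gamma>\<in>\<Delta>. coef \<theta> \<gamma> * (z \<bullet> \<gamma> - 1) = 0"
    using nn finite_simple by (subst (asm) sum_nonneg_eq_0_iff) auto
  then show "z \<bullet> \<delta> = \<rho> \<bullet> \<delta>"
    using d coef_highest_pos[OF d] rho_simple[OF d] by (force simp: inner_commute)
qed

text \<open>With \<open>t = z \<bullet> \<alpha>\<close> this is the effect of a linear reflection
  on the squared distance to \<rho>; with \<open>t = z \<bullet> \<theta> - h\<close> it covers the
  affine wall of the alcove.\<close>

lemma dist_move_root:
  assumes "\<alpha> \<in> \<Phi>"
  shows "(z - t *\<^sub>R \<alpha> - \<rho>) \<bullet> (z - t *\<^sub>R \<alpha> - \<rho>) =
    (z - \<rho>) \<bullet> (z - \<rho>) + 2 * t * (t - z \<bullet> \<alpha> + \<alpha> \<bullet> \<rho>)"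
  using inner_root_self[OF assms]
  by (simp add: inner_diff_left inner_diff_right inner_commute algebra_simps)

text \<open>Folding towards the fundamental alcove: reflecting in a wall that separates \<open>z\<close> from \<open>\<rho>\<close>
  lowers the squared distance to \<open>\<rho>\<close> by at least 2.\<close>

lemma rho_in_orbit:
  assumes cop: "coprime b h" and "z \<in> orbit b"
  shows "\<rho> \<in> orbit b"
  using assms(2)
proof (induction z rule: measure_induct_rule[where f = "\<lambda>z. nat \<lfloor>(z - \<rho>) \<bullet> (z - \<rho>)\<rfloor>"])
  case (less z)
  have descend: "\<rho> \<in> orbit b"
    if "z' \<in> orbit b" "(z' - \<rho>) \<bullet> (z' - \<rho>) \<le> (z - \<rho>) \<bullet> (z - \<rho>) - 2" for z'
  proof (rule less.IH)
    have "(z' - \<rho>) \<bullet> (z' - \<rho>) \<ge> 0"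
      by simp
    then show "nat \<lfloor>(z' - \<rho>) \<bullet> (z' - \<rho>)\<rfloor> < nat \<lfloor>(z - \<rho>) \<bullet> (z - \<rho>)\<rfloor>"
      using that(2) by linarith
  qed (rule that)
  consider (simple) \<delta> where "\<delta> \<in> \<Delta>" "z \<bullet> \<delta> < 0" | (highest) "z \<bullet> \<theta> > real h"
    | (alcove) "\<And>\<delta>. \<delta> \<in> \<Delta> \<Longrightarrow> z \<bullet> \<delta> \<ge> 0" "z \<bullet> \<theta> \<le> real h"
    by (meson not_less)
  then show ?case
  proof cases
    case simple
    have r: "\<delta> \<in> \<Phi>"
      using simple simple_in_roots by blast
    obtain k where k: "z \<bullet> \<delta> = of_int k"
      using orbit_inner[OF less.prems r cop] by blast
    then have "z \<bullet> \<delta> \<le> -1"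
      using simple by simp
    then show ?thesis
      using orbit_reflection[OF less.prems r] dist_move_root[OF r, of z "z \<bullet> \<delta>"]
      by (intro descend[of "reflection \<delta> z"]) (simp_all add: reflection_root r rho_simple simple)
  next
    case highest
    note t = highest_root_in_roots
    let ?t = "z \<bullet> \<theta> - real h"
    \<comment> \<open>The mirror image of \<open>z\<close> in the affine wall where the pairing with
      \<theta> equals \<open>h\<close>.\<close>
    let ?z = "z - ?t *\<^sub>R \<theta>"
    have "?z = reflection \<theta> z + real h *\<^sub>R \<theta>"
      by (simp add: reflection_root t algebra_simps)
    then have "?z \<in> orbit b"
      using orbit_translate orbit_reflection less.prems t root_in_lattice by metis
    moreover obtain k where k: "z \<bullet> \<theta> = of_int k"
      using orbit_inner[OF less.prems t cop] by blast
    then have "int h + 1 \<le> k"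
      using highest by linarith
    then have "real_of_int (int h + 1) \<le> real_of_int k"
      by (simp only: of_int_le_iff)
    then have "?t \<ge> 1"
      using k by simp
    moreover have "(?z - \<rho>) \<bullet> (?z - \<rho>) = (z - \<rho>) \<bullet> (z - \<rho>) - 2 * ?t"
      by (subst dist_move_root[OF t]) (simp add: inner_highest_rho algebra_simps)
    ultimately show ?thesis
      by (intro descend) auto
  next
    case alcove
    \<comment> \<open>Off the walls the integers \<open>z \<bullet> \<delta>\<close> cannot be 0 and
      \<open>z \<bullet> \<theta>\<close> cannot be \<open>h\<close>, so the weak alcove
      inequalities sharpen by 1.\<close>
    have "z = \<rho>"
    proof (rule alcove_point_eq_rho)
      fix \<delta> assume d: "\<delta> \<in> \<Delta>"
      obtain k where k: "z \<bullet> \<delta> = of_int k" "\<not> int h dvd k"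
        using orbit_inner[OF less.prems simple_in_roots[OF d] cop] by blast
      then have "k \<noteq> 0"
        by auto
      then show "z \<bullet> \<delta> \<ge> 1"
        using alcove(1)[OF d] k by simp
    next
      obtain k where k: "z \<bullet> \<theta> = of_int k" "\<not> int h dvd k"
        using orbit_inner[OF less.prems highest_root_in_roots cop] by blast
      then have "k \<noteq> int h"
        by auto
      then show "z \<bullet> \<theta> \<le> real h - 1"
        using alcove(2) k by linarith
    qed
    then show ?thesis
      using less.prems by simp
  qed
qed

subsection \<open>Trivial stabilizers\<close>

lemma lattice_sum_list:
  assumes "x \<in> Q"
  obtains xs where "set xs \<subseteq> \<Phi>" "x = sum_list xs"
proof -
  have uminus: "sum_list (map uminus ys) = - sum_list ys" for ys :: "'a list"
    by (induction ys) auto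
  from assms have "\<exists>xs. set xs \<subseteq> \<Phi> \<and> x = sum_list xs"
  proof (induction rule: group_closure.induct)
    case (base s)
    then show ?case
      by (cases "s = 0") (auto intro: exI[of _ "[]"] exI[of _ "[s]"])
  next
    case (diff s t)
    then obtain xs ys where "set xs \<subseteq> \<Phi>" "s = sum_list xs" "set ys \<subseteq> \<Phi>" "t = sum_list ys"
      by blast
    then show ?case
      using uminus_root by (intro exI[of _ "xs @ map uminus ys"]) (auto simp: uminus)
  qed
  then show thesis
    using that by blast
qed

abbreviation acute :: "'a list \<Rightarrow> bool"
  where "acute \<equiv> sorted_wrt (\<lambda>\<alpha> \<beta>. \<alpha> \<bullet> \<beta> \<ge> 0)"

text \<open>Two roots at an obtuse angle cancel or merge into a single root.\<close>

lemma acute_insert: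
  assumes "set xs \<subseteq> \<Phi>" "acute xs" "\<beta> \<in> \<Phi>"
  shows "\<exists>ys. set ys \<subseteq> \<Phi> \<and> acute ys \<and> sum_list ys = \<beta> + sum_list xs"
  using assms
\<comment> \<open>A merged root may be obtuse to remaining entries and has to be inserted again, but
  into a shorter list; hence induction on length with \<beta> arbitrary.\<close>
proof (induction xs arbitrary: \<beta> rule: length_induct)
  case (1 xs)
  show ?case
  proof (cases "\<exists>\<alpha>\<in>set xs. \<beta> \<bullet> \<alpha> < 0")
    case False
    then have "acute (\<beta> # xs)"
      using "1.prems" by force
    then show ?thesis
      using "1.prems" by (intro exI[of _ "\<beta> # xs"]) auto
  next
    case True
    then obtain \<alpha> us vs where split: "xs = us @ \<alpha> # vs" and neg: "\<beta> \<bullet> \<alpha> < 0"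
      by (metis split_list)
    have uv: "acute (us @ vs)" "set (us @ vs) \<subseteq> \<Phi>" and \<alpha>: "\<alpha> \<in> \<Phi>"
      using "1.prems" split by (auto simp: sorted_wrt_append)
    have "\<beta> = - \<alpha> \<or> \<beta> + \<alpha> \<in> \<Phi>"
      using neg root_add[OF "1.prems"(3) \<alpha>] inner_root_self[OF \<alpha>]
      by (cases rule: inner_roots_cases[OF "1.prems"(3) \<alpha>]) auto
    then show ?thesis
    proof
      assume "\<beta> = - \<alpha>"
      then show ?thesis
        using uv split by (intro exI[of _ "us @ vs"]) auto
    next
      assume "\<beta> + \<alpha> \<in> \<Phi>"
      then obtain ys where "set ys \<subseteq> \<Phi>" "acute ys" "sum_list ys = (\<beta> + \<alpha>) + sum_list (us @ vs)"
        using "1.IH"[rule_format, of "us @ vs" "\<beta> + \<alpha>"] uv split by auto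
      then show ?thesis
        using split by (intro exI[of _ ys]) (auto simp: algebra_simps)
    qed
  qed
qed

lemma lattice_acute_sum:
  assumes "x \<in> Q"
  obtains xs where "set xs \<subseteq> \<Phi>" "acute xs" "x = sum_list xs"
proof -
  obtain xs where xs: "set xs \<subseteq> \<Phi>" "x = sum_list xs"
    using lattice_sum_list[OF assms] .
  from xs(1) have "\<exists>ys. set ys \<subseteq> \<Phi> \<and> acute ys \<and> sum_list ys = sum_list xs"
  proof (induction xs)
    case Nil
    then show ?case
      by (intro exI[of _ "[]"]) auto
  next
    case (Cons \<beta> xs)
    then obtain ys where "set ys \<subseteq> \<Phi>" "acute ys" "sum_list ys = sum_list xs"
      by auto
    then show ?case
      using acute_insert[of ys \<beta>] Cons.prems by auto
  qed
  then show thesis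
    using that xs(2) by metis
qed

text \<open>Each entry contributes its square 2, and all cross terms are nonnegative.\<close>

lemma inner_acute_sum_ge:
  "set xs \<subseteq> \<Phi> \<Longrightarrow> acute xs \<Longrightarrow> sum_list xs \<bullet> sum_list xs \<ge> 2 * real (length xs)"
proof (induction xs)
  case (Cons \<alpha> xs)
  have "\<alpha> \<bullet> sum_list ys \<ge> 0" if "\<forall>\<beta>\<in>set ys. \<alpha> \<bullet> \<beta> \<ge> 0" for ys
    using that by (induction ys) (auto simp: inner_add_right)
  then have "\<alpha> \<bullet> sum_list xs \<ge> 0"
    using Cons.prems by simp
  then show ?case
    using Cons inner_root_self[of \<alpha>]
    by (simp add: inner_add_left inner_add_right inner_commute)
qed simp

text \<open>Writing \<open>x\<close> as a sum of \<open>k\<close> roots at pairwise non-obtuse angles gives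
  \<open>2 * k \<le> x \<bullet> x \<le> k\<close>.\<close>

lemma lattice_small_eq_0:
  assumes "x \<in> Q" and small: "\<And>\<alpha>. \<alpha> \<in> \<Phi> \<Longrightarrow> x \<bullet> \<alpha> \<le> 1"
  shows "x = 0"
proof -
  obtain xs where xs: "set xs \<subseteq> \<Phi>" "acute xs" "x = sum_list xs"
    using lattice_acute_sum[OF assms(1)] .
  have "x \<bullet> sum_list ys \<le> real (length ys)" if "set ys \<subseteq> \<Phi>" for ys
    using that
  proof (induction ys)
    case (Cons \<alpha> ys)
    then show ?case
      using small[of \<alpha>] by (simp add: inner_add_right)
  qed simp
  then have "x \<bullet> x \<le> real (length xs)"
    using xs by simp
  then have "length xs = 0"
    using inner_acute_sum_ge[OF xs(1,2), folded xs(3)] by linarith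
  then show ?thesis
    using xs(3) by simp
qed

section \<open>Words in simple reflections and the stabilizer of \<open>\<rho>\<close>\<close>

definition word :: "'a list \<Rightarrow> 'a \<Rightarrow> 'a"
  where "word xs = foldr (\<lambda>\<alpha> w. reflection \<alpha> \<circ> w) xs id"

lemma word_simps [simp]: "word [] = id" "word (\<alpha> # xs) = reflection \<alpha> \<circ> word xs"
  by (simp_all add: word_def)

lemma word_append: "word (xs @ ys) = word xs \<circ> word ys"
  by (induction xs) auto

lemma word_in_weyl: "set xs \<subseteq> \<Delta> \<Longrightarrow> word xs \<in> weyl_group \<Phi>"
  by (induction xs) (auto intro: weyl_group.intros simp: simple_in_roots)

lemma weyl_reflection:
  assumes "w \<in> weyl_group \<Phi>" "\<alpha> \<in> \<Phi>"
  shows "w \<circ> reflection \<alpha> = reflection (w \<alpha>) \<circ> w"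
  using assms
  by (simp add: fun_eq_iff reflection_root weyl_root weyl_inner linear_diff[OF weyl_linear]
      linear_scale[OF weyl_linear])

text \<open>The exchange condition. Applied letter by letter from the right, the word turns the
  positive root \<alpha> negative at some letter \<delta>. The image just before must be \<delta>
  itself, and then conjugation cancels that letter against the reflection in \<alpha>.\<close>

lemma word_exchange:
  assumes "set xs \<subseteq> \<Delta>" "\<alpha> \<in> \<Delta>" "- word xs \<alpha> \<in> pos"
  shows "\<exists>ys. set ys \<subseteq> \<Delta> \<and> length ys < length xs \<and> word xs \<circ> reflection \<alpha> = word ys"
  using assms
proof (induction xs)
  case Nil
  then show ?case
    using pos_not_neg simple_pos by fastforce
next
  case (Cons \<delta> xs)
  have xs: "set xs \<subseteq> \<Delta>" and d: "\<delta> \<in> \<Delta>" "\<delta> \<in> \<Phi>"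
    using Cons.prems simple_in_roots by auto
  have a: "\<alpha> \<in> \<Phi>"
    using Cons.prems simple_in_roots by auto
  have r: "word xs \<alpha> \<in> \<Phi>"
    using weyl_root[OF word_in_weyl[OF xs]] a .
  show ?case
  proof (cases "- word xs \<alpha> \<in> pos")
    case True
    then obtain ys where "set ys \<subseteq> \<Delta>" "length ys < length xs" "word xs \<circ> reflection \<alpha> = word ys"
      using Cons.IH xs Cons.prems by blast
    then show ?thesis
      using d by (intro exI[of _ "\<delta> # ys"]) (auto simp: fun_eq_iff)
  next
    case False
    then have p: "word xs \<alpha> \<in> pos"
      using pos_or_neg[OF r] by blast
    have "reflection \<delta> (word xs \<alpha>) \<notin> pos"
      using Cons.prems(3) pos_not_neg[of "reflection \<delta> (word xs \<alpha>)"] by auto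
    then have "word xs \<alpha> = \<delta>"
      using reflection_simple_pos[OF d(1) p] by blast
    then have "word xs \<circ> reflection \<alpha> = reflection \<delta> \<circ> word xs"
      using weyl_reflection[OF word_in_weyl[OF xs] a] by simp
    then have "word (\<delta> # xs) \<circ> reflection \<alpha> = word xs"
      by (simp add: fun_eq_iff reflection_reflection[OF d(2)])
    then show ?thesis
      using xs by (intro exI[of _ xs]) (simp add: fun_eq_iff)
  qed
qed

text \<open>A word fixing \<rho> preserves heights, so it keeps its last letter \<alpha> positive.
  Without that letter it makes \<alpha> negative, so the exchange condition yields a shorter word
  for the same element.\<close>

lemma word_fixing_rho:
  "set xs \<subseteq> \<Delta> \<Longrightarrow> word xs \<rho> = \<rho> \<Longrightarrow> word xs = id"
proof (induction xs rule: length_induct)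
  case (1 xs)
  show ?case
  proof (cases xs rule: rev_cases)
    case (snoc ys \<alpha>)
    have ys: "set ys \<subseteq> \<Delta>" and a: "\<alpha> \<in> \<Delta>" "\<alpha> \<in> \<Phi>"
      using "1.prems" snoc simple_in_roots by auto
    have w: "word xs \<in> weyl_group \<Phi>"
      using word_in_weyl "1.prems" by blast
    have eq: "word xs = word ys \<circ> reflection \<alpha>"
      by (simp add: snoc word_append)
    have "word xs \<alpha> \<bullet> \<rho> = 1"
      using weyl_inner[OF w, of \<alpha> \<rho>] "1.prems"(2) rho_simple[OF a(1)] by simp
    then have "word xs \<alpha> \<in> pos"
      using pos_iff_inner_rho weyl_root[OF w a(2)] by simp
    moreover have "word xs \<alpha> = - word ys \<alpha>"
      using linear_neg[OF weyl_linear[OF word_in_weyl[OF ys]], of \<alpha>]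
      by (simp add: eq reflection_root a inner_root_self scaleR_2)
    ultimately obtain zs where "set zs \<subseteq> \<Delta>" "length zs < length ys" "word xs = word zs"
      using word_exchange[OF ys a(1)] eq by auto
    then show ?thesis
      using "1.IH" "1.prems"(2) snoc by auto
  qed simp
qed

text \<open>Induction on height. A positive root pairs positively with some simple \<delta>, since
  otherwise its square would be at most 0. If it is not simple, reflecting in \<delta> gives a lower
  positive root, whose reflection is conjugated back.\<close>

lemma pos_reflection_word:
  assumes "\<alpha> \<in> pos"
  shows "\<exists>xs. set xs \<subseteq> \<Delta> \<and> reflection \<alpha> = word xs"
  using assms
proof (induction \<alpha> rule: measure_induct_rule[where f = "\<lambda>\<alpha>. nat \<lfloor>\<alpha> \<bullet> \<rho>\<rfloor>"])
  case (less \<alpha>)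
  have a: "\<alpha> \<in> \<Phi>"
    using less.prems pos_in_roots by blast
  show ?case
  proof (cases "\<alpha> \<in> \<Delta>")
    case True
    then show ?thesis
      by (intro exI[of _ "[\<alpha>]"]) auto
  next
    case False
    have "\<exists>\<delta>\<in>\<Delta>. \<alpha> \<bullet> \<delta> > 0"
    proof (rule ccontr)
      assume "\<not> ?thesis"
      then have "(\<Sum>\<delta>\<in>\<Delta>. coef \<alpha> \<delta> * (\<delta> \<bullet> \<alpha>)) \<le> 0"
        using coef_pos_nonneg[OF less.prems]
        by (intro sum_nonpos mult_nonneg_nonpos) (auto simp: inner_commute not_less)
      then show False
        using inner_coef[of \<alpha> \<alpha>] inner_root_self[OF a] by simp
    qed
    then obtain \<delta> where d: "\<delta> \<in> \<Delta>" "\<alpha> \<bullet> \<delta> > 0"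
      by blast
    have r: "\<delta> \<in> \<Phi>" and ne: "\<alpha> \<noteq> \<delta>"
      using d simple_in_roots False by auto
    let ?\<beta> = "reflection \<delta> \<alpha>"
    have p: "?\<beta> \<in> pos"
      using reflection_simple_pos d ne less.prems by blast
    have "?\<beta> \<bullet> \<rho> = \<alpha> \<bullet> \<rho> - \<alpha> \<bullet> \<delta>"
      by (simp add: reflection_root r inner_diff_left rho_simple d)
    moreover have "\<alpha> \<bullet> \<delta> \<ge> 1"
      using Ints_nonzero_abs_ge1[OF inner_roots_Ints[OF a r]] d by simp
    ultimately have "nat \<lfloor>?\<beta> \<bullet> \<rho>\<rfloor> < nat \<lfloor>\<alpha> \<bullet> \<rho>\<rfloor>"
      using inner_rho_pos[OF p] by linarith
    then obtain xs where xs: "set xs \<subseteq> \<Delta>" "reflection ?\<beta> = word xs"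
      using less.IH p by blast
    have "reflection \<delta> \<circ> reflection ?\<beta> = reflection (reflection \<delta> ?\<beta>) \<circ> reflection \<delta>"
      using weyl_reflection[OF reflection_in_weyl[OF r] pos_in_roots[OF p]] .
    then have "reflection \<delta> \<circ> word xs \<circ> reflection \<delta> = reflection \<alpha>"
      using xs(2) by (simp add: fun_eq_iff reflection_reflection[OF r])
    then have "reflection \<alpha> = word (\<delta> # xs @ [\<delta>])"
      by (simp add: word_append o_assoc)
    then show ?thesis
      using xs d by (intro exI[of _ "\<delta> # xs @ [\<delta>]"]) auto
  qed
qed

lemma weyl_word:
  assumes "w \<in> weyl_group \<Phi>"
  shows "\<exists>xs. set xs \<subseteq> \<Delta> \<and> w = word xs"
  using assms
proof (induction rule: weyl_group.induct)
  case id
  show ?case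
    by (intro exI[of _ "[]"]) auto
next
  case (step w \<alpha>)
  have "reflection (- \<alpha>) = reflection \<alpha>"
    by (simp add: fun_eq_iff reflection_def)
  then obtain ys where "set ys \<subseteq> \<Delta>" "reflection \<alpha> = word ys"
    using pos_or_neg[OF step.hyps(2)] pos_reflection_word by metis
  moreover obtain xs where "set xs \<subseteq> \<Delta>" "w = word xs"
    using step.IH by blast
  ultimately show ?case
    by (intro exI[of _ "ys @ xs"]) (auto simp: word_append)
qed

lemma weyl_fixing_rho: "w \<in> weyl_group \<Phi> \<Longrightarrow> w \<rho> = \<rho> \<Longrightarrow> w = id"
  using weyl_word word_fixing_rho by blast

text \<open>\<open>real h * (q \<bullet> \<alpha>)\<close> is a difference of two root heights, each
  below \<open>h\<close> in absolute value. So the integer \<open>q \<bullet> \<alpha>\<close> is at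
  most 1, which makes \<open>q\<close> vanish by \<open>lattice_small_eq_0\<close>; then
  \<open>w\<close> fixes \<rho>.\<close>

lemma affine_fixing_rho:
  assumes w: "w \<in> weyl_group \<Phi>" and q: "q \<in> Q" and fixed: "w \<rho> + real h *\<^sub>R q = \<rho>"
  shows "w = id" "q = 0"
proof -
  have hq: "real h *\<^sub>R q = \<rho> - w \<rho>"
    using fixed by (metis add_diff_cancel_left')
  obtain v where v: "v \<in> weyl_group \<Phi>" "\<And>x. v (w x) = x"
    using weyl_inverse[OF w] by metis
  have h0: "real h > 0"
    using coxeter_number_ge_2 by simp
  have "q \<bullet> \<alpha> \<le> 1" if a: "\<alpha> \<in> \<Phi>" for \<alpha>
  proof -
    have va: "v \<alpha> \<in> \<Phi>"
      using weyl_root v a by blast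
    have "w \<rho> \<bullet> \<alpha> = v \<alpha> \<bullet> \<rho>"
      using weyl_inner[OF v(1), of "w \<rho>" \<alpha>] v(2) by (simp add: inner_commute)
    then have "real h * (q \<bullet> \<alpha>) = \<alpha> \<bullet> \<rho> - v \<alpha> \<bullet> \<rho>"
      using arg_cong[OF hq, of "\<lambda>x. x \<bullet> \<alpha>"] by (simp add: inner_diff_left inner_diff_right inner_commute)
    also have "\<dots> < real h * 2"
      using abs_inner_rho_less[OF a] abs_inner_rho_less[OF va] by linarith
    finally have "q \<bullet> \<alpha> < 2"
      using h0 by simp
    moreover obtain k where "q \<bullet> \<alpha> = of_int k"
      using inner_lattice_root_Ints[OF q a] by (metis Ints_cases)
    ultimately show ?thesis
      by simp
  qed
  then show "q = 0"
    using lattice_small_eq_0[OF q] by blast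
  then show "w = id"
    using weyl_fixing_rho[OF w] fixed by simp
qed

section \<open>Existence and uniqueness of \<open>affine_w\<close>, and the two statistics\<close>

lemma coroot_lattice_eq: "coroot_lattice \<Phi> = Q"
proof -
  have "coroot ` \<Phi> = \<Phi>"
    using coroot_root by simp
  then show ?thesis
    by (simp add: coroot_lattice_def)
qed

text \<open>Translates between the affine action on multiples of \<rho> / \<open>h\<close> and the
  picture scaled by \<open>h\<close> that \<open>orbit\<close> uses.\<close>

lemma affine_at_rho:
  assumes "w \<in> weyl_group \<Phi>"
  shows "w ((c / real h) *\<^sub>R \<rho>) + q = (1 / real h) *\<^sub>R (w (c *\<^sub>R \<rho>) + real h *\<^sub>R q)"
  using coxeter_number_ge_2
  by (simp add: linear_scale[OF weyl_linear[OF assms]] scaleR_add_right)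

lemma affine_inj_at_rho:
  assumes f: "f \<in> affine_weyl_group \<Phi>" and g: "g \<in> affine_weyl_group \<Phi>"
    and eq: "f ((1 / real h) *\<^sub>R \<rho>) = g ((1 / real h) *\<^sub>R \<rho>)"
  shows "f = g"
proof -
  obtain w q where f': "f = (\<lambda>x. w x + q)" "w \<in> weyl_group \<Phi>" "q \<in> Q"
    using f by (auto simp: affine_weyl_group_def coroot_lattice_eq)
  obtain u r where g': "g = (\<lambda>x. u x + r)" "u \<in> weyl_group \<Phi>" "r \<in> Q"
    using g by (auto simp: affine_weyl_group_def coroot_lattice_eq)
  obtain v where v: "v \<in> weyl_group \<Phi>" "\<And>x. v (u x) = x" "\<And>x. u (v x) = x"
    using weyl_inverse[OF g'(2)] by metis
  note lin = linear_add[OF weyl_linear] linear_diff[OF weyl_linear] linear_scale[OF weyl_linear]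
  have h0: "real h \<noteq> 0"
    using coxeter_number_ge_2 by simp
  have "w \<rho> + real h *\<^sub>R q = u \<rho> + real h *\<^sub>R r"
    using eq affine_at_rho[OF f'(2), of 1 q] affine_at_rho[OF g'(2), of 1 r] h0
    by (simp add: f'(1) g'(1))
  \<comment> \<open>Applying the inverse of \<open>u\<close> produces an affine element that fixes
    \<rho> in the scaled picture.\<close>
  then have "v (w \<rho> + real h *\<^sub>R (q - r)) = v (u \<rho>)"
    by (simp add: algebra_simps)
  then have "(v \<circ> w) \<rho> + real h *\<^sub>R v (q - r) = \<rho>"
    by (simp add: lin[OF v(1)] v(2))
  then have "v \<circ> w = id" "v (q - r) = 0"
    using affine_fixing_rho[OF weyl_comp[OF v(1) f'(2)] weyl_lattice[OF group_closure.diff[OF f'(3) g'(3)] v(1)]]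
    by blast+
  then have "w x = u x" "q = r" for x
    using v(3) linear_0[OF weyl_linear[OF g'(2)]]
    by (metis comp_apply id_apply, metis eq_iff_diff_eq_0)
  then show ?thesis
    by (simp add: f'(1) g'(1))
qed

lemma affine_exists:
  assumes "coprime b h"
  shows "\<exists>f\<in>affine_weyl_group \<Phi>. f ((1 / real h) *\<^sub>R \<rho>) = (real b / real h) *\<^sub>R \<rho>"
proof -
  have "real b *\<^sub>R \<rho> \<in> orbit b"
    unfolding orbit_def by (auto intro!: exI[of _ id] exI[of _ 0] weyl_group.id)
  then have "\<rho> \<in> orbit b"
    by (rule rho_in_orbit[OF assms])
  then obtain w q where wq: "w \<in> weyl_group \<Phi>" "q \<in> Q" "\<rho> = w (real b *\<^sub>R \<rho>) + real h *\<^sub>R q"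
    by (auto simp: orbit_def)
  obtain v where v: "v \<in> weyl_group \<Phi>" "\<And>x. v (w x) = x"
    using weyl_inverse[OF wq(1)] by metis
  have "(1 / real h) *\<^sub>R \<rho> = w ((real b / real h) *\<^sub>R \<rho>) + q"
    using affine_at_rho[OF wq(1), of "real b" q] wq(3) by simp
  \<comment> \<open>Folding carries \<open>b\<close> \<rho> / \<open>h\<close> to \<rho> /
    \<open>h\<close>; the inverse map, with translation part \<open>- v q\<close>, goes in the
    required direction.\<close>
  then have "v ((1 / real h) *\<^sub>R \<rho>) + (- v q) = (real b / real h) *\<^sub>R \<rho>"
    by (simp add: linear_add[OF weyl_linear[OF v(1)]] v(2))
  moreover have "(\<lambda>x. v x + (- v q)) \<in> affine_weyl_group \<Phi>"
    unfolding affine_weyl_group_def coroot_lattice_eq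
    using v(1) weyl_lattice[OF wq(2) v(1)] group_closure_minus_iff by blast
  ultimately show ?thesis
    by (rule bexI)
qed

lemma affine_w_props:
  assumes "coprime b h"
  shows "affine_w \<Phi> \<Delta> b \<in> affine_weyl_group \<Phi>"
    and "affine_w \<Phi> \<Delta> b ((1 / real h) *\<^sub>R \<rho>) = (real b / real h) *\<^sub>R \<rho>"
proof -
  let ?P = "\<lambda>f. f \<in> affine_weyl_group \<Phi> \<and> f ((1 / real h) *\<^sub>R \<rho>) = (real b / real h) *\<^sub>R \<rho>"
  obtain f where f: "?P f"
    using affine_exists[OF assms] by blast
  have "?P (affine_w \<Phi> \<Delta> b)"
    unfolding affine_w_def
  proof (rule theI[of ?P])
    show "g = f" if "?P g" for g
      using affine_inj_at_rho[of g f] that f by simp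
  qed (rule f)
  then show "affine_w \<Phi> \<Delta> b \<in> affine_weyl_group \<Phi>"
    and "affine_w \<Phi> \<Delta> b ((1 / real h) *\<^sub>R \<rho>) = (real b / real h) *\<^sub>R \<rho>"
    by blast+
qed

lemma affine_isometry: "f \<in> affine_weyl_group \<Phi> \<Longrightarrow> norm (f x - f y) = norm (x - y)"
proof -
  assume "f \<in> affine_weyl_group \<Phi>"
  then obtain w q where f: "f = (\<lambda>x. w x + q)" "w \<in> weyl_group \<Phi>"
    by (auto simp: affine_weyl_group_def)
  have "f x - f y = w (x - y)"
    by (simp add: f linear_diff[OF weyl_linear])
  then show ?thesis
    using weyl_inner[OF f(2)] by (simp add: norm_eq_sqrt_inner)
qed

lemma affine_surj:
  assumes "f \<in> affine_weyl_group \<Phi>"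
  shows "surj f"
proof -
  obtain w q where f: "f = (\<lambda>x. w x + q)" "w \<in> weyl_group \<Phi>"
    using assms by (auto simp: affine_weyl_group_def)
  obtain v where v: "\<And>x. w (v x) = x"
    using weyl_inverse[OF f(2)] by metis
  show ?thesis
    by (rule surjI[of _ "\<lambda>x. v (x - q)"]) (simp add: f v)
qed

text \<open>Completing the square leaves the constant
  \<open>(\<rho> \<bullet> \<rho>) / (2 * real h)\<close>, which the strange formula
  evaluates.\<close>

lemma size_stat_eq:
  "size_stat \<Phi> \<Delta> y = real h / 2 * (norm (y - (1 / real h) *\<^sub>R \<rho>))\<^sup>2 - real DIM('a) * (real h + 1) / 24"
proof -
  have h0: "real h \<noteq> 0"
    using coxeter_number_ge_2 by simp
  have "real h / 2 * (norm (y - (1 / real h) *\<^sub>R \<rho>))\<^sup>2 =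
      real h / 2 * (y \<bullet> y) - y \<bullet> \<rho> + (\<rho> \<bullet> \<rho>) / (2 * real h)"
    using h0
    by (simp add: power2_norm_eq_inner inner_diff_left inner_diff_right inner_commute field_simps)
  moreover have "(\<rho> \<bullet> \<rho>) / (2 * real h) = real DIM('a) * (real h + 1) / 24"
    using strange_formula h0 by (simp add: field_simps)
  ultimately show ?thesis
    unfolding size_stat_def dual_coxeter_number_eq weyl_vector_eq_covector power2_norm_eq_inner[of y]
    by linarith
qed

lemma zise_stat_eq:
  assumes "coprime b h"
  shows "zise_stat \<Phi> \<Delta> b x =
    real h / 2 * (norm (x - (real b / real h) *\<^sub>R \<rho>))\<^sup>2 - real DIM('a) * (real h + 1) / 24"
proof -
  let ?f = "affine_w \<Phi> \<Delta> b"
  note f = affine_w_props[OF assms]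
  have "norm (inv ?f x - (1 / real h) *\<^sub>R \<rho>) = norm (x - (real b / real h) *\<^sub>R \<rho>)"
    using affine_isometry[OF f(1), of "inv ?f x" "(1 / real h) *\<^sub>R \<rho>"] affine_surj[OF f(1)] f(2)
    by (simp add: surj_f_inv_f)
  then show ?thesis
    by (simp add: zise_stat_def size_stat_eq)
qed

end

theorem theorem6p9:
  fixes \<Phi> \<Delta> :: "'a::euclidean_space set" and n h b :: nat
  assumes "irreducible_root_system \<Phi>"
    and "simply_laced \<Phi>"
    and "simple_roots \<Phi> \<Delta>"
    and "n = dim \<Phi>"
    and "h = coxeter_number \<Phi> \<Delta>"
    and "b > 0"
    and "coprime b h"
  shows "\<forall>x. zise_stat \<Phi> \<Delta> b x =
           real h / 2 * (norm (x - (real b / real h) *\<^sub>R weyl_covector \<Delta>))\<^sup>2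
             - real n * (real h + 1) / 24"
proof -
  interpret simply_laced_roots \<Phi> \<Delta>
    by unfold_locales (fact assms)+
  have "dim \<Phi> = DIM('a)"
    by (metis dim_UNIV dim_span span_roots)
  then show ?thesis
    using zise_stat_eq assms(4,5,7) by simp
qed

end
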